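(* There exists an infinite Galois extension $L/\mathbb{Q}$ contained in $\mathbb{Q}^{(2)}_{ab}$, satisfying property $(\mathfrak{S})$ and also the following condition: there exists a nested sequence of number fields $K_0\subsetneq K_1\subsetneq K_2\subsetneq\cdots$ with $L=\bigcup_i K_i$ such that $$\inf_{K_{i-1}\subsetneq M\subseteq K_i}\left(N_{K_{i-1}/\mathbb{Q}}\left(D_{M/K_{i-1}}\right)\right)^{\frac{1}{[M:K_0][M:K_{i-1}]}}\longrightarrow\infty\quad\text{as } i\to\infty,$$ where the infimum is over all intermediate fields $M$ strictly larger than $K_{i-1}$ and contained in $K_i$.
   Context: $\overline{\mathbb{Q}}$ is a fixed algebraic closure of $\mathbb{Q}$ and $\mathcal{P}$ is the set of rational primes. $\mathbb{Q}^{(2)}_{ab}$ is the compositum in $\overline{\mathbb{Q}}$ of all abelian extensions of $\mathbb{Q}$ of degree at most $2$. $D_{M/K_{i-1}}$ is the relative discriminant (ideal) of $M/K_{i-1}$, and $N_{K_{i-1}/\mathbb{Q}}(D_{M/K_{i-1}})$ denotes the unique positive integer generating its norm ideal. For a (possibly infinite) Galois extension $L/\mathbb{Q}$ inside $\overline{\mathbb{Q}}$ and a prime $p$, let $e_p(L)$ and $f_p(L)$ be the (possibly infinite) ramification index and inertia (residue) degree of $L/\mathbb{Q}$ at $p$; since $L/\mathbb{Q}$ is Galois these depend only on $p$. Set $$\mathfrak{S}_p(L)=\frac{\log p}{e_p(L)\,(p^{f_p(L)}+1)},$$ with the convention $\mathfrak{S}_p(L)=0$ if $L$ cannot be embedded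 in a finite extension of $\mathbb{Q}_p$ (i.e. if $e_p(L)$ or $f_p(L)$ is infinite). Put $\mathfrak{S}(L)=\sum_{p\in\mathcal{P}}\mathfrak{S}_p(L)\in[0,+\infty]$. A field $L\subseteq\overline{\mathbb{Q}}$ has property $(\mathfrak{S})$ if $L/\mathbb{Q}$ is Galois and $\mathfrak{S}(L)=+\infty$. *)

theory Defs
  imports
    "HOL-Algebra.Algebraic_Closure_Type"
    "HOL-Algebra.Generated_Fields"
    "HOL-Algebra.Ideal_Product"
    "HOL-Algebra.IntRing"
    "HOL-Analysis.Infinite_Sum"
    "HOL-Library.Extended_Nonnegative_Real"
    "Jordan_Normal_Form.Determinant"
begin

text \<open>All fields are subfields (sets of elements) of the fixed algebraic closure of \<open>\<rat>\<close>, the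
  library type \<^typ>\<open>rat alg_closure\<close>; \<open>\<rat> :: qbar set\<close> is the prime field.\<close>

type_synonym qbar = "rat alg_closure"

abbreviation Qbar :: "qbar ring" where
  "Qbar \<equiv> ring_of_type_algebra"

abbreviation subring_of_Qbar :: "qbar set \<Rightarrow> qbar ring" where
  "subring_of_Qbar A \<equiv> Qbar\<lparr>carrier := A\<rparr>"

abbreviation finite_ext :: "qbar set \<Rightarrow> qbar set \<Rightarrow> bool" where
  "finite_ext K M \<equiv> ring.finite_dimension Qbar K M"

abbreviation ext_degree :: "qbar set \<Rightarrow> qbar set \<Rightarrow> nat" where
  "ext_degree K M \<equiv> ring.dim Qbar K M"

definition number_field :: "qbar set \<Rightarrow> bool" where
  "number_field K \<longleftrightarrow> subfield K Qbar \<and> finite_ext \<rat> K"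

text \<open>Subfields of \<^typ>\<open>qbar\<close> are algebraic and separable over \<open>\<rat>\<close>, so Galois means normal. As
  \<^typ>\<open>qbar\<close> is algebraically closed, a polynomial splits over \<open>L\<close> iff all its roots in
  \<^typ>\<open>qbar\<close> lie in \<open>L\<close>.\<close>

definition galois_ext :: "qbar set \<Rightarrow> bool" where
  "galois_ext L \<longleftrightarrow> subfield L Qbar \<and>
     (\<forall>p :: rat poly. irreducible p \<longrightarrow> (\<exists>x\<in>L. poly (map_poly to_ac p) x = 0) \<longrightarrow>
        (\<forall>x. poly (map_poly to_ac p) x = 0 \<longrightarrow> x \<in> L))"

text \<open>Maps defined on a field \<open>M\<close> are made unique as HOL functions by \<^const>\<open>extensional\<close>.\<close>

definition galois_group :: "qbar set \<Rightarrow> (qbar \<Rightarrow> qbar) monoid" where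
  "galois_group L =
     \<lparr>carrier = ring_iso (subring_of_Qbar L) (subring_of_Qbar L) \<inter> extensional L
                \<inter> {\<sigma>. \<forall>x\<in>\<rat>. \<sigma> x = x},
      monoid.mult = compose L,
      one = (\<lambda>x\<in>L. x)\<rparr>"

definition Q2ab :: "qbar set" where
  "Q2ab = generate_field Qbar
     (\<Union>{K. number_field K \<and> galois_ext K \<and> comm_group (galois_group K) \<and> ext_degree \<rat> K \<le> 2})"

definition embeddings :: "qbar set \<Rightarrow> qbar set \<Rightarrow> (qbar \<Rightarrow> qbar) set" where
  "embeddings K M = Ring.ring_hom (subring_of_Qbar M) Qbar \<inter> extensional M \<inter> {\<sigma>. \<forall>x\<in>K. \<sigma> x = x}"

definition rel_trace :: "qbar set \<Rightarrow> qbar set \<Rightarrow> qbar \<Rightarrow> qbar" where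
  "rel_trace K M x = (\<Sum>\<sigma>\<in>embeddings K M. \<sigma> x)"

definition rel_norm :: "qbar set \<Rightarrow> qbar set \<Rightarrow> qbar \<Rightarrow> qbar" where
  "rel_norm K M x = (\<Prod>\<sigma>\<in>embeddings K M. \<sigma> x)"

abbreviation integers_of :: "qbar set \<Rightarrow> qbar ring" where
  "integers_of K \<equiv> subring_of_Qbar {x \<in> K. algebraic_int x}"

definition basis_disc :: "qbar set \<Rightarrow> qbar set \<Rightarrow> qbar list \<Rightarrow> qbar" where
  "basis_disc K M bs =
     Determinant.det (Matrix.mat (length bs) (length bs) (\<lambda>(i, j). rel_trace K M (bs ! i * bs ! j)))"

text \<open>The relative discriminant of \<open>M/K\<close> is the ideal of the integers of \<open>K\<close> generated by the
  discriminants of all \<open>K\<close>-bases of \<open>M\<close> that consist of integral elements.\<close>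

definition rel_discriminant :: "qbar set \<Rightarrow> qbar set \<Rightarrow> qbar set" where
  "rel_discriminant K M = Idl\<^bsub>integers_of K\<^esub>
     {basis_disc K M bs | bs. set bs \<subseteq> carrier (integers_of M) \<and>
        ring.independent Qbar K bs \<and> ring.Span Qbar K bs = M}"

text \<open>The norm ideal of an ideal \<open>I\<close> of the integers of \<open>K\<close> is the ideal of \<open>\<int>\<close> generated by the
  norms of the elements of \<open>I\<close>.\<close>

definition norm_ideal :: "qbar set \<Rightarrow> qbar set \<Rightarrow> int set" where
  "norm_ideal K I = Idl\<^bsub>\<Z>\<^esub> {m :: int. \<exists>x\<in>I. of_int m = rel_norm \<rat> K x}"

definition ideal_norm :: "qbar set \<Rightarrow> qbar set \<Rightarrow> nat" where
  "ideal_norm K I = (THE n. n > 0 \<and> Idl\<^bsub>\<Z>\<^esub> {int n} = norm_ideal K I)"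

text \<open>\<open>primes_above L p\<close> is meant for arbitrary (also infinite) algebraic \<open>L\<close>.\<close>

definition primes_above :: "qbar set \<Rightarrow> nat \<Rightarrow> qbar set set" where
  "primes_above L p = {P. primeideal P (integers_of L) \<and> of_nat p \<in> P}"

text \<open>The exponent of \<open>P\<close> in \<open>p\<close>, for a number field \<open>K\<close> and \<open>P \<in> primes_above K p\<close>.\<close>

definition ram_exponent :: "qbar set \<Rightarrow> qbar set \<Rightarrow> nat \<Rightarrow> nat" where
  "ram_exponent K P p = (GREATEST e. of_nat p \<in> P [^]\<^bsub>ideals_set (integers_of K)\<^esub> e)"

text \<open>For infinite \<open>L\<close> the ramification index is the supremum over the number fields contained
  in \<open>L\<close>; the prime below \<open>P\<close> in such a field \<open>K\<close> is \<open>P \<inter> K\<close>.\<close>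

definition ram_index_at :: "qbar set \<Rightarrow> qbar set \<Rightarrow> nat \<Rightarrow> enat" where
  "ram_index_at L P p =
     (SUP K\<in>{K. number_field K \<and> K \<subseteq> L}. enat (ram_exponent K (P \<inter> K) p))"

text \<open>The degree of the residue field of \<open>P\<close> over its prime field, the image of \<open>\<int>\<close>.\<close>

definition inertia_degree_at :: "qbar set \<Rightarrow> qbar set \<Rightarrow> enat" where
  "inertia_degree_at L P =
     (let F = integers_of L Quot P;
          F0 = range (\<lambda>m :: int. P +>\<^bsub>integers_of L\<^esub> of_int m)
      in if ring.finite_dimension F F0 (carrier F) then enat (ring.dim F F0 (carrier F)) else \<infinity>)"

text \<open>For Galois \<open>L\<close> the following two do not depend on the chosen prime above \<open>p\<close>.\<close>

definition ram_index :: "qbar set \<Rightarrow> nat \<Rightarrow> enat" where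
  "ram_index L p = ram_index_at L (SOME P. P \<in> primes_above L p) p"

definition inertia_degree :: "qbar set \<Rightarrow> nat \<Rightarrow> enat" where
  "inertia_degree L p = inertia_degree_at L (SOME P. P \<in> primes_above L p)"

definition S_local :: "qbar set \<Rightarrow> nat \<Rightarrow> real" where
  "S_local L p =
     (case (ram_index L p, inertia_degree L p) of
        (enat e, enat f) \<Rightarrow> ln (real p) / (real e * (real p ^ f + 1))
      | _ \<Rightarrow> 0)"

definition S_total :: "qbar set \<Rightarrow> ennreal" where
  "S_total L = (\<Sum>\<^sub>\<infinity>p\<in>{p. prime p}. ennreal (S_local L p))"

definition property_S :: "qbar set \<Rightarrow> bool" where
  "property_S L \<longleftrightarrow> galois_ext L \<and> S_total L = \<infinity>"

end

theory Submission
  imports Defs "Jordan_Normal_Form.Char_Poly" "HOL-Number_Theory.Euler_Criterion" "HOL-Analysis.Harmonic_Numbers"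
begin

text \<open>Take \<open>L\<close> to be generated by the square roots of odd, squarefree, pairwise coprime integers
  \<open>d\<^sub>0, d\<^sub>1, \<dots>\<close> that tend to infinity, and \<open>K\<^sub>n\<close> by the first \<open>n\<close> of them. As \<open>d\<^sub>n\<close> is coprime to
  \<open>2 d\<^sub>0 \<cdots> d\<^sub>n\<^sub>-\<^sub>1\<close>, it divides the relative discriminant of \<open>K\<^sub>n\<^sub>+\<^sub>1/K\<^sub>n\<close>, whose norm is therefore at
  least \<open>d\<^sub>n\<close> to the power \<open>2\<^sup>n\<close>, and the quantity in question is at least the fourth root of \<open>d\<^sub>n\<close>.
  A prime \<open>p\<close> modulo which all \<open>d\<^sub>i\<close> are nonzero squares splits completely in every \<open>K\<^sub>n\<close> and
  contributes \<open>log p / (p + 1)\<close> to \<open>S(L)\<close>. The \<open>d\<^sub>n\<close> are chosen one by one: each is a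
  square modulo all primes up to a bound below which the sum over the primes that split in \<open>K\<^sub>n\<close>
  already exceeds \<open>n\<close>. The sum over all primes that split stays divergent because, of two coprime
  candidates and their product, at least one is a square modulo any given prime. This avoids any
  density theorem for split primes.\<close>

section \<open>Sums and products of algebraic integers\<close>

text \<open>The primes that split for all radicands form a decreasing intersection, and divergence
  at every finite stage would not pass to it; hence at each stage a finite set of primes with large
  sum is frozen. Freezing works because the squarefree part of m^2 + 1 is a square modulo every
  prime divisor of m, and m may contain a factorial. The discriminant bound rests on one statement:
  for an algebraic integer u of \<open>K n\<close> and D squarefree, coprime to 2 and to the earlier
  radicands, D divides u as soon as it divides u^2. It yields both the properness of each step of
  the tower and the divisibility of relative discriminants by \<open>d n\<close>. The fourth root
  arises because the degrees multiply to 2^(n+2) while the norm contributes the exponent 2^n.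
  Splitting is tested on a prime P of the integers of the infinite field L. One element outside P
  that multiplies P into the multiples of p at a given level shows that p generates P locally; an
  induction producing rational integers congruent to given elements settles ramification and residue
  field together.\<close>

definition int_span :: "'a::field_char_0 set \<Rightarrow> 'a set" where
  "int_span B = range (\<lambda>c. \<Sum>b\<in>B. of_int (c b) * b)"

lemma int_spanI: "x = (\<Sum>b\<in>B. of_int (c b) * b) \<Longrightarrow> x \<in> int_span B"
  by (auto simp: int_span_def)

lemma int_span_base:
  assumes "finite B" "b \<in> B" shows "b \<in> int_span B"
proof (rule int_spanI[where c = "\<lambda>x. of_bool (x = b)"])
  have "(\<Sum>x\<in>B. of_int (of_bool (x = b)) * x) = (\<Sum>x\<in>B. if x = b then x else 0)"
    by (intro sum.cong) auto
  then show "b = (\<Sum>x\<in>B. of_int (of_bool (x = b)) * x)"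
    using assms by simp
qed

lemma int_span_0: "0 \<in> int_span B"
  by (rule int_spanI[where c = "\<lambda>_. 0"]) simp

lemma int_span_add:
  assumes "x \<in> int_span B" "y \<in> int_span B" shows "x + y \<in> int_span B"
proof -
  obtain c c' where "x = (\<Sum>b\<in>B. of_int (c b) * b)" "y = (\<Sum>b\<in>B. of_int (c' b) * b)"
    using assms by (auto simp: int_span_def)
  then show ?thesis
    by (intro int_spanI[where c = "\<lambda>b. c b + c' b"]) (simp add: algebra_simps sum.distrib)
qed

lemma int_span_scale:
  assumes "x \<in> int_span B" shows "of_int k * x \<in> int_span B"
proof -
  obtain c where "x = (\<Sum>b\<in>B. of_int (c b) * b)"
    using assms by (auto simp: int_span_def)
  then show ?thesis
    by (intro int_spanI[where c = "\<lambda>b. k * c b"]) (simp add: algebra_simps sum_distrib_left)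
qed

lemma int_span_sum: "(\<And>i. i \<in> I \<Longrightarrow> f i \<in> int_span B) \<Longrightarrow> sum f I \<in> int_span B"
  by (induction I rule: infinite_finite_induct) (auto intro: int_span_0 int_span_add)

lemma int_span_mult_closed:
  assumes "\<And>b. b \<in> B \<Longrightarrow> z * b \<in> int_span B" "x \<in> int_span B"
  shows "z * x \<in> int_span B"
proof -
  obtain c where "x = (\<Sum>b\<in>B. of_int (c b) * b)"
    using assms by (auto simp: int_span_def)
  then have "z * x = (\<Sum>b\<in>B. of_int (c b) * (z * b))"
    by (simp add: sum_distrib_left algebra_simps)
  also have "\<dots> \<in> int_span B"
    using assms(1) by (intro int_span_sum int_span_scale)
  finally show ?thesis .
qed

text \<open>\<open>z\<close> is an eigenvalue of the integer matrix of multiplication by \<open>z\<close>.\<close>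

lemma algebraic_int_of_int_span:
  fixes z :: "'a::field_char_0"
  assumes "finite B" "1 \<in> B" and closed: "\<And>b. b \<in> B \<Longrightarrow> z * b \<in> int_span B"
  shows "algebraic_int z"
proof -
  obtain bs where bs: "set bs = B" "distinct bs"
    using finite_distinct_list[OF assms(1)] by blast
  define n where "n = length bs"
  have "\<forall>b\<in>B. \<exists>c. z * b = (\<Sum>b'\<in>B. of_int (c b') * b')"
    using closed by (auto simp: int_span_def)
  then obtain c where c: "\<And>b. b \<in> B \<Longrightarrow> z * b = (\<Sum>b'\<in>B. of_int (c b b') * b')"
    by metis
  define A :: "int mat" where "A = Matrix.mat n n (\<lambda>(i, j). c (bs ! i) (bs ! j))"
  define v where "v = vec_of_list bs"
  have A: "A \<in> carrier_mat n n" by (simp add: A_def)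
  have dim_v: "dim_vec v = n" "\<And>i. i < n \<Longrightarrow> v $ i = bs ! i"
    by (auto simp: v_def n_def vec_of_list_index)
  interpret of_int_hom: comm_ring_hom "of_int :: int \<Rightarrow> 'a" by unfold_locales auto
  have "map_mat of_int A *\<^sub>v v = z \<cdot>\<^sub>v v"
  proof (rule eq_vecI)
    fix i assume "i < dim_vec (z \<cdot>\<^sub>v v)"
    then have i: "i < n" by (simp add: dim_v)
    have "(map_mat of_int A *\<^sub>v v) $ i = (\<Sum>j<n. of_int (c (bs ! i) (bs ! j)) * bs ! j)"
      using i by (simp add: A_def dim_v scalar_prod_def atLeast0LessThan)
    also have "\<dots> = (\<Sum>b\<in>B. of_int (c (bs ! i) b) * b)"
      by (rule sum.reindex_bij_betw) (use bij_betw_nth[OF bs(2) _ bs(1)[symmetric], of "{..<n}"] in \<open>simp add: n_def\<close>)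
    also have "\<dots> = z * bs ! i"
      by (rule c[symmetric]) (use i bs in \<open>auto simp: n_def\<close>)
    finally show "(map_mat of_int A *\<^sub>v v) $ i = (z \<cdot>\<^sub>v v) $ i" using i by (simp add: dim_v)
  qed (simp add: A_def dim_v)
  moreover have "v \<noteq> 0\<^sub>v n"
  proof
    assume "v = 0\<^sub>v n"
    then have "\<And>i. i < n \<Longrightarrow> bs ! i = 0" using dim_v by (metis index_zero_vec(1))
    with assms(2) bs show False by (auto simp: in_set_conv_nth n_def)
  qed
  ultimately have "eigenvalue (map_mat of_int A) z"
    using A dim_v by (auto simp: eigenvalue_def eigenvector_def intro!: exI[of _ v] carrier_vecI)
  then have "poly (char_poly (map_mat of_int A)) z = 0"
    using eigenvalue_root_char_poly[of "map_mat of_int A" n z] A by simp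
  moreover have "char_poly (map_mat of_int A) = map_poly (of_int :: int \<Rightarrow> 'a) (char_poly A)"
    using A by (rule of_int_hom.char_poly_hom)
  moreover have "lead_coeff (char_poly A) = 1"
    using degree_monic_char_poly[OF A] by simp
  ultimately show ?thesis
    by (auto simp: algebraic_int_altdef_ipoly)
qed

lemma algebraic_int_power_reduction:
  fixes x :: "'a::field_char_0"
  assumes "algebraic_int x"
  obtains n c where "n > 0" "x ^ n = (\<Sum>i<n. of_int (c i) * x ^ i)"
proof -
  obtain p where p: "poly (map_poly of_int p) x = 0" "lead_coeff p = 1"
    using assms by (auto simp: algebraic_int_altdef_ipoly)
  define n where "n = Polynomial.degree p"
  have "(\<Sum>i\<le>n. of_int (poly.coeff p i) * x ^ i) = 0"
    using p(1) by (simp add: poly_altdef n_def coeff_map_poly degree_map_poly)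
  then have eq: "x ^ n = (\<Sum>i<n. of_int (- poly.coeff p i) * x ^ i)"
    using p(2) by (simp add: n_def[symmetric] lessThan_Suc_atMost[symmetric] sum_negf add_eq_0_iff)
  have "n > 0"
  proof (rule ccontr)
    assume "\<not> n > 0"
    then have "p = [:1:]" using p(2) unfolding n_def by (metis degree_0_id neq0_conv)
    with p(1) show False by simp
  qed
  then show ?thesis using eq by (rule that)
qed

text \<open>Monic equations of degrees m and n for x and y make the finitely many products x^i y^j
  with i < m and j < n span a module stable under multiplication by x and by y. One module thus
  serves the sum and the product.\<close>

lemma
  fixes x y :: "'a::field_char_0"
  assumes x: "algebraic_int x" and y: "algebraic_int y"
  shows algebraic_int_add: "algebraic_int (x + y)"
    and algebraic_int_mult: "algebraic_int (x * y)"
proof -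
  obtain m c where m: "m > 0" "x ^ m = (\<Sum>i<m. of_int (c i) * x ^ i)"
    using x by (rule algebraic_int_power_reduction)
  obtain n c' where n: "n > 0" "y ^ n = (\<Sum>i<n. of_int (c' i) * y ^ i)"
    using y by (rule algebraic_int_power_reduction)
  define B where "B = (\<lambda>(i, j). x ^ i * y ^ j) ` ({..<m} \<times> {..<n})"
  have fin: "finite B" by (simp add: B_def)
  have B: "x ^ i * y ^ j \<in> int_span B" if "i < m" "j < n" for i j
    using that fin by (intro int_span_base) (auto simp: B_def)
  have one_B: "1 \<in> B" using m(1) n(1) by (auto simp: B_def intro!: image_eqI[of _ _ "(0, 0)"])
  have xB: "x * b \<in> int_span B" if "b \<in> B" for b
  proof -
    from that obtain i j where b: "b = x ^ i * y ^ j" "i < m" "j < n" by (auto simp: B_def)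
    show ?thesis
    proof (cases "Suc i < m")
      case True
      then show ?thesis using B[of "Suc i" j] b by (simp add: algebra_simps)
    next
      case False
      then have "Suc i = m" using b by simp
      then have "x * b = x ^ m * y ^ j" using b(1) by (metis mult.assoc power_Suc)
      also have "\<dots> = (\<Sum>k<m. of_int (c k) * x ^ k) * y ^ j"
        by (rule arg_cong[OF m(2)])
      also have "\<dots> = (\<Sum>k<m. of_int (c k) * (x ^ k * y ^ j))"
        by (simp only: sum_distrib_right mult.assoc)
      also have "\<dots> \<in> int_span B"
        using b by (intro int_span_sum int_span_scale B) auto
      finally show ?thesis .
    qed
  qed
  have yB: "y * b \<in> int_span B" if "b \<in> B" for b
  proof -
    from that obtain i j where b: "b = x ^ i * y ^ j" "i < m" "j < n" by (auto simp: B_def)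
    show ?thesis
    proof (cases "Suc j < n")
      case True
      then show ?thesis using B[of i "Suc j"] b by (simp add: algebra_simps)
    next
      case False
      then have "Suc j = n" using b by simp
      then have "y * b = x ^ i * y ^ n" using b(1) by (metis mult.left_commute power_Suc)
      also have "\<dots> = x ^ i * (\<Sum>k<n. of_int (c' k) * y ^ k)"
        by (rule arg_cong[OF n(2)])
      also have "\<dots> = (\<Sum>k<n. of_int (c' k) * (x ^ i * y ^ k))"
        by (simp only: sum_distrib_left mult.left_commute)
      also have "\<dots> \<in> int_span B"
        using b by (intro int_span_sum int_span_scale B) auto
      finally show ?thesis .
    qed
  qed
  show "algebraic_int (x + y)"
  proof (rule algebraic_int_of_int_span)
    fix b assume "b \<in> B"
    then show "(x + y) * b \<in> int_span B"
      unfolding distrib_right by (intro int_span_add xB yB)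
  qed (rule fin one_B)+
  show "algebraic_int (x * y)"
  proof (rule algebraic_int_of_int_span)
    fix b assume "b \<in> B"
    then show "(x * y) * b \<in> int_span B"
      unfolding mult.assoc using int_span_mult_closed[of B x "y * b"] xB yB by blast
  qed (rule fin one_B)+
qed

lemma algebraic_int_diff:
  "algebraic_int x \<Longrightarrow> algebraic_int y \<Longrightarrow> algebraic_int (x - y :: 'a::field_char_0)"
  using algebraic_int_add[of x "-y"] by simp

lemma algebraic_int_power: "algebraic_int x \<Longrightarrow> algebraic_int (x ^ n :: 'a::field_char_0)"
  by (induction n) (auto intro: algebraic_int_mult)

lemma algebraic_int_prod:
  "(\<And>i. i \<in> A \<Longrightarrow> algebraic_int (f i)) \<Longrightarrow> algebraic_int (\<Prod>i\<in>A. f i :: 'a::field_char_0)"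
  by (induction A rule: infinite_finite_induct) (auto intro: algebraic_int_mult)

lemma algebraic_int_of_power:
  fixes x :: "'a::field_char_0"
  assumes "algebraic_int (x ^ n)" "n > 0"
  shows "algebraic_int x"
proof (rule algebraic_int_root[OF assms(1), of "Polynomial.monom 1 n"])
  show "poly (Polynomial.monom 1 n) x = x ^ n" by (simp add: poly_monom)
qed (use assms(2) in \<open>auto simp: degree_monom_eq\<close>)

section \<open>Subfields of the algebraic closure and their embeddings\<close>

lemma field_Qbar: "field Qbar"
  by (rule field_from_type_algebra)

interpretation Qbar: cring Qbar
  by (rule cring_from_type_algebra)

lemma Qbar_simps [simp]:
  fixes x y :: qbar
  shows "carrier Qbar = UNIV" "x \<otimes>\<^bsub>Qbar\<^esub> y = x * y" "x \<oplus>\<^bsub>Qbar\<^esub> y = x + y"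
    "\<one>\<^bsub>Qbar\<^esub> = 1" "\<zero>\<^bsub>Qbar\<^esub> = 0"
  by (simp_all add: ring_of_type_algebra_def)

lemma Qbar_minus [simp]: "\<ominus>\<^bsub>Qbar\<^esub> x = - x" "x \<ominus>\<^bsub>Qbar\<^esub> y = x - y"
proof -
  show minus: "\<ominus>\<^bsub>Qbar\<^esub> x = - x" for x
    using Qbar.minus_equality[of "- x" x] by simp
  show "x \<ominus>\<^bsub>Qbar\<^esub> y = x - y"
    unfolding a_minus_def by (simp add: minus)
qed

lemma Qbar_inv [simp]: "x \<noteq> 0 \<Longrightarrow> inv\<^bsub>Qbar\<^esub> x = inverse x"
  by (rule Qbar.comm_inv_char) auto

lemma subfield_QbarI:
  assumes "1 \<in> K" "\<And>x y. x \<in> K \<Longrightarrow> y \<in> K \<Longrightarrow> x - y \<in> K" "\<And>x y. x \<in> K \<Longrightarrow> y \<in> K \<Longrightarrow> x * y \<in> K"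
    and "\<And>x. x \<in> K \<Longrightarrow> x \<noteq> 0 \<Longrightarrow> inverse x \<in> K"
  shows "subfield K Qbar"
proof (rule field.subfieldI'[OF field_Qbar])
  have 0: "0 \<in> K" using assms(2)[OF assms(1) assms(1)] by simp
  have minus: "- x \<in> K" if "x \<in> K" for x using assms(2)[OF 0 that] by simp
  have "x + y \<in> K" if "x \<in> K" "y \<in> K" for x y using assms(2)[OF that(1) minus[OF that(2)]] by simp
  then show "subring K Qbar"
    using assms minus by (intro Qbar.subringI) auto
qed (use assms in auto)

context
  fixes K assumes K: "subfield K Qbar"
begin

lemma subfield_Qbar_closed:
  shows "1 \<in> K" "0 \<in> K" "x \<in> K \<Longrightarrow> y \<in> K \<Longrightarrow> x + y \<in> K" "x \<in> K \<Longrightarrow> y \<in> K \<Longrightarrow> x * y \<in> K"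
    "x \<in> K \<Longrightarrow> - x \<in> K" "x \<in> K \<Longrightarrow> y \<in> K \<Longrightarrow> x - y \<in> K" "x \<in> K \<Longrightarrow> inverse x \<in> K"
    "x \<in> K \<Longrightarrow> y \<in> K \<Longrightarrow> x / y \<in> K"
proof -
  note R = subringE[OF subfieldE(1)[OF K], simplified]
  show 1: "1 \<in> K" "0 \<in> K" "x \<in> K \<Longrightarrow> y \<in> K \<Longrightarrow> x + y \<in> K" "x \<in> K \<Longrightarrow> - x \<in> K" for x y
    using R by auto
  show 2: "x \<in> K \<Longrightarrow> y \<in> K \<Longrightarrow> x * y \<in> K" for x y
    using R by auto
  show "x \<in> K \<Longrightarrow> y \<in> K \<Longrightarrow> x - y \<in> K"
    using 1(3)[of x "- y"] 1(4)[of y] by simp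
  show 3: "x \<in> K \<Longrightarrow> inverse x \<in> K" for x
    using Qbar.subfield_m_inv(1)[OF K, of x] 1(2) by (cases "x = 0") auto
  show "x \<in> K \<Longrightarrow> y \<in> K \<Longrightarrow> x / y \<in> K"
    using 2 3 by (simp add: divide_inverse)
qed

lemma subfield_Qbar_of_nat: "of_nat n \<in> K"
  by (induction n) (auto intro: subfield_Qbar_closed)

lemma subfield_Qbar_numeral: "numeral n \<in> K"
  using subfield_Qbar_of_nat[of "numeral n"] by simp

lemma subfield_Qbar_of_int: "of_int n \<in> K"
  by (cases n rule: int_cases2) (auto intro: subfield_Qbar_closed subfield_Qbar_of_nat)

lemma subfield_Qbar_Rats: "\<rat> \<subseteq> K"
proof
  fix x :: qbar assume "x \<in> \<rat>"
  then show "x \<in> K"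
    by (cases rule: Rats_cases') (auto intro: subfield_Qbar_closed subfield_Qbar_of_int)
qed

lemma subfield_Qbar_power: "x \<in> K \<Longrightarrow> x ^ n \<in> K"
  by (induction n) (auto intro: subfield_Qbar_closed)

lemma subfield_Qbar_sum: "(\<And>i. i \<in> A \<Longrightarrow> f i \<in> K) \<Longrightarrow> sum f A \<in> K"
  by (induction A rule: infinite_finite_induct) (auto intro: subfield_Qbar_closed)

lemma subfield_Qbar_prod: "(\<And>i. i \<in> A \<Longrightarrow> f i \<in> K) \<Longrightarrow> prod f A \<in> K"
  by (induction A rule: infinite_finite_induct) (auto intro: subfield_Qbar_closed)

end

lemmas subfield_Qbar_intros = subfield_Qbar_closed subfield_Qbar_of_nat subfield_Qbar_numeral subfield_Qbar_of_int
  subfield_Qbar_power subfield_Qbar_sum subfield_Qbar_prod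

lemma subfield_Rats: "subfield \<rat> Qbar"
  by (rule subfield_QbarI) auto

lemma embeddings_iff:
  "\<sigma> \<in> embeddings K M \<longleftrightarrow>
     (\<forall>x\<in>M. \<forall>y\<in>M. \<sigma> (x * y) = \<sigma> x * \<sigma> y \<and> \<sigma> (x + y) = \<sigma> x + \<sigma> y) \<and> \<sigma> 1 = 1 \<and>
     \<sigma> \<in> extensional M \<and> (\<forall>x\<in>K. \<sigma> x = x)"
  by (auto simp: embeddings_def Ring.ring_hom_def)

context
  fixes K M \<sigma> assumes \<sigma>: "\<sigma> \<in> embeddings K M" and M: "subfield M Qbar"
begin

lemma embeddings_basic:
  "x \<in> M \<Longrightarrow> y \<in> M \<Longrightarrow> \<sigma> (x * y) = \<sigma> x * \<sigma> y" "x \<in> M \<Longrightarrow> y \<in> M \<Longrightarrow> \<sigma> (x + y) = \<sigma> x + \<sigma> y"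
  "\<sigma> 1 = 1" "\<sigma> 0 = 0" "x \<in> M \<Longrightarrow> \<sigma> (- x) = - \<sigma> x" "x \<in> M \<Longrightarrow> y \<in> M \<Longrightarrow> \<sigma> (x - y) = \<sigma> x - \<sigma> y"
  "x \<in> K \<Longrightarrow> \<sigma> x = x"
proof -
  note c = subfield_Qbar_closed[OF M]
  show m: "x \<in> M \<Longrightarrow> y \<in> M \<Longrightarrow> \<sigma> (x * y) = \<sigma> x * \<sigma> y" "\<sigma> 1 = 1" "x \<in> K \<Longrightarrow> \<sigma> x = x" for x y
    using \<sigma> by (auto simp: embeddings_iff)
  show a: "x \<in> M \<Longrightarrow> y \<in> M \<Longrightarrow> \<sigma> (x + y) = \<sigma> x + \<sigma> y" for x y
    using \<sigma> by (auto simp: embeddings_iff)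
  show z: "\<sigma> 0 = 0" using a[of 0 0] c(2) by simp
  show n: "x \<in> M \<Longrightarrow> \<sigma> (- x) = - \<sigma> x" for x
    using a[of x "- x"] c(5) z by (simp add: eq_neg_iff_add_eq_0 add.commute)
  show "x \<in> M \<Longrightarrow> y \<in> M \<Longrightarrow> \<sigma> (x - y) = \<sigma> x - \<sigma> y"
    using a[of x "- y"] c(5) n by simp
qed

lemma embeddings_of_int: "\<sigma> (of_int k) = of_int k"
proof -
  have nat: "\<sigma> (of_nat k) = of_nat k" for k
    by (induction k) (auto simp: embeddings_basic subfield_Qbar_intros[OF M])
  show ?thesis
    by (cases k rule: int_cases2) (auto simp: nat embeddings_basic subfield_Qbar_intros[OF M])
qed

lemma embeddings_power: "x \<in> M \<Longrightarrow> \<sigma> (x ^ n) = \<sigma> x ^ n"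
  by (induction n) (auto simp: embeddings_basic subfield_Qbar_intros[OF M])

lemma embeddings_sum: "(\<And>i. i \<in> A \<Longrightarrow> f i \<in> M) \<Longrightarrow> \<sigma> (sum f A) = (\<Sum>i\<in>A. \<sigma> (f i))"
  by (induction A rule: infinite_finite_induct) (auto simp: embeddings_basic subfield_Qbar_intros[OF M])

text \<open>An embedding fixes the integers, so it sends a root of a monic integer polynomial to
  another root.\<close>

lemma embeddings_algebraic_int:
  assumes "x \<in> M" "algebraic_int x" shows "algebraic_int (\<sigma> x)"
proof -
  obtain p where p: "poly (map_poly of_int p) x = 0" "lead_coeff p = 1"
    using assms(2) by (auto simp: algebraic_int_altdef_ipoly)
  have "poly (map_poly of_int p) (\<sigma> x) = \<sigma> (poly (map_poly of_int p) x)"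
    by (simp add: poly_altdef coeff_map_poly embeddings_basic embeddings_of_int embeddings_power
        embeddings_sum subfield_Qbar_intros[OF M] assms(1))
  with p show ?thesis
    using embeddings_basic(4) by (auto simp: algebraic_int_altdef_ipoly)
qed

end

lemma embeddings_self: "subfield K Qbar \<Longrightarrow> embeddings K K = {\<lambda>x\<in>K. x}"
  by (auto simp: embeddings_iff extensional_def restrict_def fun_eq_iff subfield_Qbar_intros)

section \<open>Quadratic extensions\<close>

definition quad_ext :: "qbar set \<Rightarrow> qbar \<Rightarrow> qbar set" where
  "quad_ext F s = {a + b * s | a b. a \<in> F \<and> b \<in> F}"

lemma quad_extI: "a \<in> F \<Longrightarrow> b \<in> F \<Longrightarrow> a + b * s \<in> quad_ext F s"
  by (auto simp: quad_ext_def)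

lemma quad_extE:
  assumes "x \<in> quad_ext F s" obtains a b where "a \<in> F" "b \<in> F" "x = a + b * s"
  using assms by (auto simp: quad_ext_def)

text \<open>The extension to F(s) of a map \<open>\<tau>\<close> on F that sends s to t.
  \<open>SOME\<close> picks the coordinates of x, which are unique once s \<notin> F. The
  restriction keeps the function extensional, as \<open>embeddings\<close> demands.\<close>

definition quad_lift :: "qbar set \<Rightarrow> qbar \<Rightarrow> (qbar \<Rightarrow> qbar) \<Rightarrow> qbar \<Rightarrow> qbar \<Rightarrow> qbar" where
  "quad_lift F s \<tau> t = (\<lambda>x\<in>quad_ext F s.
     let (a, b) = (SOME (a, b). a \<in> F \<and> b \<in> F \<and> x = a + b * s) in \<tau> a + \<tau> b * t)"

context
  fixes F s assumes F: "subfield F Qbar" and s2: "s ^ 2 \<in> F"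
begin

lemma quad_ext_mult:
  "(a + b * s) * (c + e * s) = (a * c + b * e * s ^ 2) + (a * e + b * c) * s"
  by (simp add: algebra_simps power2_eq_square)

lemma subset_quad_ext: "F \<subseteq> quad_ext F s"
  using quad_extI[of _ F 0 s] subfield_Qbar_intros[OF F] by auto

lemma root_in_quad_ext: "s \<in> quad_ext F s"
  using quad_extI[of 0 F 1 s] subfield_Qbar_intros[OF F] by auto

lemma subfield_quad_ext: "subfield (quad_ext F s) Qbar"
proof (rule subfield_QbarI)
  note c = subfield_Qbar_closed[OF F]
  show "1 \<in> quad_ext F s" using subset_quad_ext c by auto
  fix x assume "x \<in> quad_ext F s"
  then obtain a b where x: "a \<in> F" "b \<in> F" "x = a + b * s" by (rule quad_extE)
  show "x - y \<in> quad_ext F s" if "y \<in> quad_ext F s" for y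
  proof -
    obtain a' b' where y: "a' \<in> F" "b' \<in> F" "y = a' + b' * s" using \<open>y \<in> _\<close> by (rule quad_extE)
    have "x - y = (a - a') + (b - b') * s" using x y by (simp add: algebra_simps)
    also have "\<dots> \<in> quad_ext F s" using x y by (intro quad_extI c)
    finally show ?thesis .
  qed
  show mult: "x * y \<in> quad_ext F s" if "y \<in> quad_ext F s" for y
  proof -
    obtain a' b' where y: "a' \<in> F" "b' \<in> F" "y = a' + b' * s" using \<open>y \<in> _\<close> by (rule quad_extE)
    show ?thesis unfolding x(3) y(3) quad_ext_mult
      using x y c s2 by (intro quad_extI) auto
  qed
  \<comment> \<open>Rationalising the denominator with a - b s breaks down when this conjugate
    vanishes. As s \<in> F is still allowed here, that case is treated apart: then b = 0 or s = a /
    b, and x \<in> F.\<close>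
  show "inverse x \<in> quad_ext F s" if "x \<noteq> 0"
  proof (cases "a - b * s = 0")
    case True
    show ?thesis
    proof (cases "b = 0")
      case True
      then show ?thesis using x c subset_quad_ext by auto
    next
      case False
      with True have "s = a / b" by (simp add: field_simps)
      then have "x \<in> F" using x c by auto
      then show ?thesis using c subset_quad_ext by auto
    qed
  next
    case False
    have "x * (a - b * s) = a ^ 2 - b ^ 2 * s ^ 2"
      using x(3) by (simp add: algebra_simps power2_eq_square)
    then have "inverse x = (a - b * s) * inverse (a ^ 2 - b ^ 2 * s ^ 2)"
      using False that by (simp flip: \<open>x * (a - b * s) = _\<close>)
    also have "\<dots> = a * inverse (a ^ 2 - b ^ 2 * s ^ 2) + (- b * inverse (a ^ 2 - b ^ 2 * s ^ 2)) * s"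
      by (simp add: algebra_simps)
    also have "\<dots> \<in> quad_ext F s"
      using x c s2 subfield_Qbar_power[OF F, of a 2] subfield_Qbar_power[OF F, of b 2]
      by (intro quad_extI) auto
    finally show ?thesis .
  qed
qed

lemma quad_ext_least:
  assumes "subfield M Qbar" "F \<subseteq> M" "s \<in> M" shows "quad_ext F s \<subseteq> M"
proof
  fix x assume "x \<in> quad_ext F s"
  then obtain a b where x: "a \<in> F" "b \<in> F" "x = a + b * s" by (rule quad_extE)
  then show "x \<in> M" using assms by (auto intro!: subfield_Qbar_intros[OF assms(1)])
qed

context
  assumes s: "s \<notin> F"
begin

lemma quad_ext_unique:
  assumes "a \<in> F" "b \<in> F" "c \<in> F" "e \<in> F" "a + b * s = c + e * s"
  shows "a = c" "b = e"
proof -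
  show "b = e"
  proof (rule ccontr)
    assume "b \<noteq> e"
    then have "s = (c - a) / (b - e)" using assms(5) by (simp add: field_simps)
    then show False using s assms subfield_Qbar_intros[OF F] by auto
  qed
  then show "a = c" using assms(5) by simp
qed

lemma quad_ext_psubset: "F \<subset> quad_ext F s"
  using subset_quad_ext root_in_quad_ext s by auto

text \<open>An element a + b s of M outside F has b \<noteq> 0, and solving for s puts s into M. In
  the tower this leaves the infimum over intermediate fields with a single term.\<close>

lemma quad_ext_no_intermediate:
  assumes "subfield M Qbar" "F \<subset> M" "M \<subseteq> quad_ext F s" shows "M = quad_ext F s"
proof -
  obtain x where x: "x \<in> M" "x \<notin> F" using assms(2) by auto
  then obtain a b where ab: "a \<in> F" "b \<in> F" "x = a + b * s" using assms(3) by (meson quad_extE subsetD)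
  with x subfield_Qbar_intros[OF F] have "b \<noteq> 0" by auto
  then have "s = (x - a) / b" using ab by (simp add: field_simps)
  also have "\<dots> \<in> M"
    using ab x assms by (intro subfield_Qbar_intros[OF assms(1)]) auto
  finally show ?thesis using quad_ext_least[OF assms(1)] assms by auto
qed

lemma dimension_quad_ext: "Qbar.dimension 2 F (quad_ext F s)"
proof -
  have "quad_ext F s = Qbar.line_extension F s F"
    unfolding quad_ext_def set_eq_iff Qbar.line_extension_mem_iff
    by (simp add: add.commute) (metis add.commute)
  moreover have "Qbar.dimension (Suc 1) F (Qbar.line_extension F s F)"
    using s Qbar.dimension_one[OF F] by (intro Qbar.Suc_dim) auto
  ultimately show ?thesis by (simp add: numeral_2_eq_2)
qed

lemma quad_lift_eq:
  assumes "a \<in> F" "b \<in> F" shows "quad_lift F s \<tau> t (a + b * s) = \<tau> a + \<tau> b * t"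
proof -
  have "(SOME (a', b'). a' \<in> F \<and> b' \<in> F \<and> a + b * s = a' + b' * s) = (a, b)"
  proof (rule some_equality)
    fix p assume "case p of (a', b') \<Rightarrow> a' \<in> F \<and> b' \<in> F \<and> a + b * s = a' + b' * s"
    then show "p = (a, b)"
      using quad_ext_unique[of a b "fst p" "snd p"] assms by (auto simp: case_prod_unfold prod_eq_iff)
  qed (use assms in simp)
  then show ?thesis using assms by (simp add: quad_lift_def quad_extI)
qed

lemma quad_lift_base: "a \<in> F \<Longrightarrow> \<tau> 0 = 0 \<Longrightarrow> quad_lift F s \<tau> t a = \<tau> a"
  using quad_lift_eq[of a 0] subfield_Qbar_closed(2)[OF F] by simp

lemma quad_lift_root: "\<tau> 0 = 0 \<Longrightarrow> \<tau> 1 = 1 \<Longrightarrow> quad_lift F s \<tau> t s = t"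
  using quad_lift_eq[of 0 1] subfield_Qbar_closed(1,2)[OF F] by simp

text \<open>The condition on t is what multiplicativity demands: products are reduced by s^2 before
  the lift and by t^2 after it.\<close>

lemma quad_lift_embedding:
  assumes \<tau>: "\<tau> \<in> embeddings K F" and K: "K \<subseteq> F" and t: "t ^ 2 = \<tau> (s ^ 2)"
  shows "quad_lift F s \<tau> t \<in> embeddings K (quad_ext F s)"
  unfolding embeddings_iff
proof (intro conjI ballI)
  note e = embeddings_basic[OF \<tau> F]
  note c = subfield_Qbar_closed[OF F]
  fix x y assume "x \<in> quad_ext F s" "y \<in> quad_ext F s"
  then obtain a b a' b' where xy: "a \<in> F" "b \<in> F" "x = a + b * s" "a' \<in> F" "b' \<in> F" "y = a' + b' * s"
    by (meson quad_extE)
  have "quad_lift F s \<tau> t (x * y) = \<tau> (a * a' + b * b' * s ^ 2) + \<tau> (a * b' + b * a') * t"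
    unfolding xy(3,6) quad_ext_mult using xy c s2 by (intro quad_lift_eq) auto
  also have "\<dots> = (\<tau> a + \<tau> b * t) * (\<tau> a' + \<tau> b' * t)"
    using xy e c s2 by (simp add: t[symmetric]) (simp add: algebra_simps power2_eq_square)
  finally show "quad_lift F s \<tau> t (x * y) = quad_lift F s \<tau> t x * quad_lift F s \<tau> t y"
    using xy quad_lift_eq by simp
  have "x + y = (a + a') + (b + b') * s" using xy by (simp add: algebra_simps)
  then have "quad_lift F s \<tau> t (x + y) = \<tau> (a + a') + \<tau> (b + b') * t"
    using xy c(3) by (simp only: quad_lift_eq)
  also have "\<dots> = (\<tau> a + \<tau> b * t) + (\<tau> a' + \<tau> b' * t)"
    using xy e by (simp add: algebra_simps)
  finally show "quad_lift F s \<tau> t (x + y) = quad_lift F s \<tau> t x + quad_lift F s \<tau> t y"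
    using xy quad_lift_eq by simp
next
  note e = embeddings_basic[OF \<tau> F]
  show "quad_lift F s \<tau> t 1 = 1" using quad_lift_base[of 1] e subfield_Qbar_closed(1)[OF F] by simp
  show "quad_lift F s \<tau> t \<in> extensional (quad_ext F s)" by (simp add: quad_lift_def)
  show "quad_lift F s \<tau> t x = x" if "x \<in> K" for x
    using quad_lift_base[of x] e that K by auto
qed

text \<open>With s^2 in the base field, every embedding fixes s^2 and can only send s to s or -s;
  conversely both signs extend each embedding of F. The base K is separate from F because norms use
  K = \<rat> and relative traces use K = F.\<close>

lemma embeddings_quad_ext:
  assumes K: "subfield K Qbar" "K \<subseteq> F" and sK: "s ^ 2 \<in> K"
  shows "embeddings K (quad_ext F s) = (\<lambda>(\<tau>, t). quad_lift F s \<tau> t) ` (embeddings K F \<times> {s, - s})"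
proof (intro equalityI subsetI)
  fix \<sigma> assume "\<sigma> \<in> (\<lambda>(\<tau>, t). quad_lift F s \<tau> t) ` (embeddings K F \<times> {s, - s})"
  then obtain \<tau> t where \<tau>: "\<tau> \<in> embeddings K F" "t = s \<or> t = - s" "\<sigma> = quad_lift F s \<tau> t"
    by auto
  then have "t ^ 2 = \<tau> (s ^ 2)"
    using embeddings_basic(7)[OF \<tau>(1) F sK] by auto
  then show "\<sigma> \<in> embeddings K (quad_ext F s)"
    using quad_lift_embedding[OF \<tau>(1) K(2)] \<tau>(3) by simp
next
  fix \<sigma> assume \<sigma>: "\<sigma> \<in> embeddings K (quad_ext F s)"
  note e = embeddings_basic[OF \<sigma> subfield_quad_ext]
  note FE = subsetD[OF subset_quad_ext]
  have r: "restrict \<sigma> F \<in> embeddings K F"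
    using e K FE by (auto simp: embeddings_iff subfield_Qbar_intros[OF F])
  have "\<sigma> s ^ 2 = s ^ 2"
    using e(1)[OF root_in_quad_ext root_in_quad_ext] e(7)[OF sK] by (simp add: power2_eq_square)
  then have "\<sigma> s \<in> {s, - s}" by (simp add: power2_eq_iff)
  moreover have "\<sigma> = quad_lift F s (restrict \<sigma> F) (\<sigma> s)"
  proof (rule extensionalityI[of _ "quad_ext F s"])
    show "\<sigma> \<in> extensional (quad_ext F s)" using \<sigma> by (simp add: embeddings_iff)
    show "quad_lift F s (restrict \<sigma> F) (\<sigma> s) \<in> extensional (quad_ext F s)" by (simp add: quad_lift_def)
    fix x assume "x \<in> quad_ext F s"
    then obtain a b where ab: "a \<in> F" "b \<in> F" "x = a + b * s" by (rule quad_extE)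
    then show "\<sigma> x = quad_lift F s (restrict \<sigma> F) (\<sigma> s) x"
      using e FE root_in_quad_ext by (simp add: quad_lift_eq subfield_Qbar_intros[OF subfield_quad_ext])
  qed
  ultimately show "\<sigma> \<in> (\<lambda>(\<tau>, t). quad_lift F s \<tau> t) ` (embeddings K F \<times> {s, - s})"
    using r by (auto intro!: image_eqI[of _ _ "(restrict \<sigma> F, \<sigma> s)"])
qed

lemma inj_on_quad_lift:
  "inj_on (\<lambda>(\<tau>, t). quad_lift F s \<tau> t) (embeddings K F \<times> {s, - s})"
proof (intro inj_onI, clarsimp simp del: insert_iff)
  fix \<tau> t \<tau>' t' assume *: "\<tau> \<in> embeddings K F" "\<tau>' \<in> embeddings K F"
    "quad_lift F s \<tau> t = quad_lift F s \<tau>' t'"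
  have e: "\<tau> 0 = 0" "\<tau> 1 = 1" "\<tau>' 0 = 0" "\<tau>' 1 = 1"
    using embeddings_basic(3,4)[OF *(1) F] embeddings_basic(3,4)[OF *(2) F] by auto
  have "t = t'"
    using quad_lift_root[of \<tau> t] quad_lift_root[of \<tau>' t'] *(3) e by simp
  moreover have "\<tau> = \<tau>'"
  proof (rule extensionalityI[of _ F])
    show "\<tau> \<in> extensional F" "\<tau>' \<in> extensional F" using * by (auto simp: embeddings_iff)
    show "\<tau> x = \<tau>' x" if "x \<in> F" for x
      using quad_lift_base[OF that, of \<tau> t] quad_lift_base[OF that, of \<tau>' t'] *(3) e by simp
  qed
  ultimately show "\<tau> = \<tau>' \<and> t = t'" by simp
qed

lemma quad_ext_embeddings_base:
  "embeddings F (quad_ext F s) = {quad_lift F s (\<lambda>x\<in>F. x) s, quad_lift F s (\<lambda>x\<in>F. x) (- s)}"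
  unfolding embeddings_quad_ext[OF F subset_refl s2] embeddings_self[OF F] by simp

lemma quad_conjugate_algebraic_int:
  assumes "a \<in> F" "b \<in> F" "algebraic_int (a + b * s)"
  shows "algebraic_int (a - b * s)"
proof -
  have "quad_lift F s (\<lambda>x\<in>F. x) (- s) \<in> embeddings F (quad_ext F s)"
    unfolding quad_ext_embeddings_base by simp
  from embeddings_algebraic_int[OF this subfield_quad_ext quad_extI[OF assms(1,2)] assms(3)]
  show ?thesis using assms by (simp add: quad_lift_eq)
qed

lemma s_nonzero: "s \<noteq> 0" "s \<noteq> - s"
proof -
  show "s \<noteq> 0" using s subfield_Qbar_closed(2)[OF F] by auto
  then show "s \<noteq> - s" by simp
qed

text \<open>Embeddings of F(s) come in pairs over those of F. This turns absolute norms and the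
  number of embeddings into inductions along the tower and gives the relative trace in one
  step.\<close>

lemma
  assumes "subfield K Qbar" "K \<subseteq> F" "s ^ 2 \<in> K"
  shows prod_embeddings_quad_ext: "(\<Prod>\<sigma>\<in>embeddings K (quad_ext F s). g \<sigma>) =
      (\<Prod>\<tau>\<in>embeddings K F. g (quad_lift F s \<tau> s) * g (quad_lift F s \<tau> (- s)) :: 'a::comm_monoid_mult)"
    and sum_embeddings_quad_ext: "(\<Sum>\<sigma>\<in>embeddings K (quad_ext F s). h \<sigma>) =
      (\<Sum>\<tau>\<in>embeddings K F. h (quad_lift F s \<tau> s) + h (quad_lift F s \<tau> (- s)) :: 'b::comm_monoid_add)"
    and card_embeddings_quad_ext: "card (embeddings K (quad_ext F s)) = 2 * card (embeddings K F)"
proof -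
  note E = embeddings_quad_ext[OF assms]
  show "(\<Prod>\<sigma>\<in>embeddings K (quad_ext F s). g \<sigma>) =
      (\<Prod>\<tau>\<in>embeddings K F. g (quad_lift F s \<tau> s) * g (quad_lift F s \<tau> (- s)))"
    using s_nonzero prod.cartesian_product[of "\<lambda>\<tau> t. g (quad_lift F s \<tau> t)" "{s, - s}" "embeddings K F"]
    unfolding E prod.reindex[OF inj_on_quad_lift] by (simp add: case_prod_unfold comp_def)
  show "(\<Sum>\<sigma>\<in>embeddings K (quad_ext F s). h \<sigma>) =
      (\<Sum>\<tau>\<in>embeddings K F. h (quad_lift F s \<tau> s) + h (quad_lift F s \<tau> (- s)))"
    using s_nonzero sum.cartesian_product[of "\<lambda>\<tau> t. h (quad_lift F s \<tau> t)" "{s, - s}" "embeddings K F"]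
    unfolding E sum.reindex[OF inj_on_quad_lift] by (simp add: case_prod_unfold comp_def)
  show "card (embeddings K (quad_ext F s)) = 2 * card (embeddings K F)"
    unfolding E card_image[OF inj_on_quad_lift]
    using s_nonzero by (simp add: card_cartesian_product)
qed

end
end

section \<open>Towers of quadratic extensions\<close>

definition nat_sqrt :: "nat \<Rightarrow> qbar" where
  "nat_sqrt n = (SOME x. x ^ 2 = of_nat n)"

lemma nat_sqrt_power2 [simp]: "nat_sqrt n ^ 2 = of_nat n"
  unfolding nat_sqrt_def by (rule someI_ex) (rule nth_root_exists, simp)

lemma nat_sqrt_mult_self: "nat_sqrt n * nat_sqrt n = of_nat n"
  using nat_sqrt_power2[of n] by (simp add: power2_eq_square)

lemma algebraic_int_nat_sqrt: "algebraic_int (nat_sqrt n)"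
  by (rule algebraic_int_of_power[of _ 2]) auto

fun multiquad :: "(nat \<Rightarrow> nat) \<Rightarrow> nat \<Rightarrow> qbar set" where
  "multiquad d 0 = \<rat>"
| "multiquad d (Suc n) = quad_ext (multiquad d n) (nat_sqrt (d n))"

lemma subfield_multiquad: "subfield (multiquad d n) Qbar"
proof (induction n)
  case (Suc n)
  then show ?case using subfield_quad_ext subfield_Qbar_of_nat by simp
qed (simp add: subfield_Rats)

lemma multiquad_mono: "m \<le> n \<Longrightarrow> multiquad d m \<subseteq> multiquad d n"
proof (induction rule: dec_induct)
  case (step n)
  then show ?case
    using subset_quad_ext[OF subfield_multiquad[of d n], of "nat_sqrt (d n)"]
    by (simp add: subfield_Qbar_of_nat[OF subfield_multiquad] order.trans)
qed simp

lemma nat_sqrt_in_multiquad: "i < n \<Longrightarrow> nat_sqrt (d i) \<in> multiquad d n"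
  using multiquad_mono[of "Suc i" n d] root_in_quad_ext[OF subfield_multiquad[of d i], of "nat_sqrt (d i)"]
  by (auto simp: subfield_Qbar_of_nat[OF subfield_multiquad])

section \<open>Divisibility by natural numbers among algebraic integers\<close>

lemma algebraic_int_coprime_mult:
  fixes y :: "'a::field_char_0"
  assumes "coprime m n" "algebraic_int (of_nat m * y)" "algebraic_int (of_nat n * y)"
  shows "algebraic_int y"
proof -
  obtain a b where ab: "a * int m + b * int n = 1"
    using bezout_int[of "int m" "int n"] assms(1) by auto
  have "of_int a * (of_nat m * y) + of_int b * (of_nat n * y) = of_int (a * int m + b * int n) * y"
    by (simp add: algebra_simps)
  also have "\<dots> = y" by (simp add: ab)
  finally show ?thesis
    using assms algebraic_int_add algebraic_int_mult algebraic_int_of_int by metis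
qed

text \<open>Write n = e g and k = f g with g = gcd n k and e coprime to f. Then e divides f^2 g,
  hence g, so e^2 divides n and e = 1.\<close>

lemma squarefree_dvd_power2_iff:
  fixes n k :: nat
  assumes "squarefree n" shows "n dvd k ^ 2 \<longleftrightarrow> n dvd k"
proof
  assume dvd: "n dvd k ^ 2"
  define g where "g = gcd n k"
  have "n \<noteq> 0" using assms by (metis not_squarefree_0)
  then have "g \<noteq> 0" by (simp add: g_def)
  obtain e f where ef: "n = e * g" "k = f * g" "coprime e f"
    using gcd_coprime_exists[of n k] \<open>g \<noteq> 0\<close> unfolding g_def by blast
  have "e dvd f ^ 2 * g"
    using dvd ef \<open>g \<noteq> 0\<close> by (simp add: power2_eq_square mult.assoc mult.left_commute)
  then have "e dvd g"
    using ef(3) by (simp add: coprime_dvd_mult_right_iff coprime_commute)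
  then have "e ^ 2 dvd n" by (auto simp: ef(1) power2_eq_square)
  then have "e dvd 1" using assms squarefreeD by blast
  then show "n dvd k" using ef by simp
qed (simp add: dvd_power dvd_trans)

lemma algebraic_int_of_int_div_iff:
  assumes "D > 0"
  shows "algebraic_int (of_int k / of_nat D :: 'a::field_char_0) \<longleftrightarrow> int D dvd k"
proof
  assume "algebraic_int (of_int k / of_nat D :: 'a)"
  then have "(of_int k / of_nat D :: 'a) \<in> \<int>"
    by (rule rational_algebraic_int_is_int) auto
  then obtain j where "(of_int k / of_nat D :: 'a) = of_int j" by (auto elim: Ints_cases)
  then have "(of_int k :: 'a) = of_int (j * int D)" using assms by (simp add: field_simps)
  then show "int D dvd k" by (simp only: of_int_eq_iff) simp
next
  assume "int D dvd k"
  then show "algebraic_int (of_int k / of_nat D :: 'a)" using assms by auto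
qed

text \<open>The square of the quotient is 1/n. For a radicand this is the contradiction that keeps
  the new root out of the preceding field.\<close>

lemma nat_sqrt_not_divisible:
  assumes "n > 1" shows "\<not> algebraic_int (nat_sqrt n / of_nat n)"
proof
  assume "algebraic_int (nat_sqrt n / of_nat n)"
  then have "algebraic_int ((nat_sqrt n / of_nat n) ^ 2)" by (rule algebraic_int_power)
  moreover have "(nat_sqrt n / of_nat n) ^ 2 = of_int 1 / of_nat n"
    using assms by (simp add: power_divide) (simp add: power2_eq_square)
  ultimately show False
    using assms algebraic_int_of_int_div_iff[of n 1, where 'a = qbar] by simp
qed

text \<open>Oddness makes each radicand coprime to the 2 that enters when u is recovered from its
  sum and difference with its conjugate; pairwise coprimality does the same for the factors d i that
  come from multiplying by s i.\<close>

locale multiquad_tower =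
  fixes d :: "nat \<Rightarrow> nat"
  assumes squarefree_d: "squarefree (d n)" and d_gt_1: "d n > 1" and odd_d: "odd (d n)"
    and coprime_d: "m \<noteq> n \<Longrightarrow> coprime (d m) (d n)"
begin

abbreviation "K \<equiv> multiquad d"
abbreviation "s n \<equiv> nat_sqrt (d n)"

lemma s2_in_K: "s n ^ 2 \<in> K m"
  by (simp add: subfield_Qbar_of_nat[OF subfield_multiquad])

lemma d_coprime_prefix: "coprime (d n) (2 * (\<Prod>i<n. d i))"
  using odd_d coprime_d by (auto intro!: prod_coprime_right)

text \<open>In the step, the conjugate \<open>u'\<close> of \<open>u\<close> also satisfies the hypotheses, and so does \<open>u u'\<close>
  because its square does; thus the squares of \<open>u + u'\<close> and \<open>(u - u') s\<close>, which lie in the smaller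
  field, are divisible by \<open>D\<close>.\<close>

lemma divides_of_divides_power2:
  assumes "u \<in> K n" "algebraic_int u" "squarefree D" "coprime D (2 * (\<Prod>i<n. d i))"
    "algebraic_int (u ^ 2 / of_nat D)"
  shows "algebraic_int (u / of_nat D)"
  using assms
proof (induction n arbitrary: u D)
  case 0
  then obtain k where u: "u = of_int k"
    using rational_algebraic_int_is_int by (auto elim: Ints_cases)
  have D: "D > 0" using 0(3) by (metis not_squarefree_0 neq0_conv)
  have "int D dvd k ^ 2"
    using 0 D algebraic_int_of_int_div_iff[OF D, of "k ^ 2", where 'a = qbar] by (simp add: u)
  then have "D dvd nat \<bar>k\<bar> ^ 2"
    by (simp flip: int_dvd_int_iff)
  then have "D dvd nat \<bar>k\<bar>"
    using squarefree_dvd_power2_iff[OF 0(3)] by simp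
  then show ?case
    using D by (simp add: u algebraic_int_of_int_div_iff flip: int_dvd_int_iff)
next
  case (Suc n)
  define F where "F = K n"
  note F = subfield_multiquad[of d n, folded F_def]
  have s2: "s n ^ 2 \<in> F" unfolding F_def by (rule s2_in_K)
  \<comment> \<open>At u = s n and D = d n the quotient u^2 / D is 1, so the induction hypothesis
    itself rules out s n \<in> F.\<close>
  have s: "s n \<notin> F"
  proof
    assume "s n \<in> F"
    then have "algebraic_int (s n / of_nat (d n))"
      using Suc.IH[of "s n" "d n"] squarefree_d d_coprime_prefix d_gt_1[of n]
      by (simp add: algebraic_int_nat_sqrt F_def)
    then show False using nat_sqrt_not_divisible[OF d_gt_1] by simp
  qed
  have D: "D > 0" using Suc.prems(3) by (metis not_squarefree_0 neq0_conv)
  obtain a b where u: "a \<in> F" "b \<in> F" "u = a + b * s n"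
    using Suc.prems(1) by (auto simp: F_def elim: quad_extE)
  note conj = quad_conjugate_algebraic_int[OF F s2 s]
  define u' where "u' = a - b * s n"
  have int_u': "algebraic_int u'"
    using conj[OF u(1,2)] Suc.prems(2) u(3) by (simp add: u'_def)
  \<comment> \<open>A and B are the coordinates of u^2 / D, so u'^2 / D is its conjugate A - B s and
    is integral as well.\<close>
  define A B where "A = (a ^ 2 + b ^ 2 * of_nat (d n)) / of_nat D" and "B = 2 * a * b / of_nat D"
  have AB: "A \<in> F" "B \<in> F"
    unfolding A_def B_def using u by (auto intro!: subfield_Qbar_intros[OF F])
  have "of_nat (d n) = s n ^ 2" by simp
  then have "u ^ 2 / of_nat D = A + B * s n" "u' ^ 2 / of_nat D = A - B * s n"
    unfolding A_def B_def u(3) u'_def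
    by (simp_all add: add_divide_distrib diff_divide_distrib power2_eq_square algebra_simps del: nat_sqrt_power2)
  then have u'2: "algebraic_int (u' ^ 2 / of_nat D)"
    using conj[OF AB] Suc.prems(5) by simp
  have "(u * u' / of_nat D) ^ 2 = (u ^ 2 / of_nat D) * (u' ^ 2 / of_nat D)"
    by (simp add: power2_eq_square)
  then have uu': "algebraic_int (u * u' / of_nat D)"
    using algebraic_int_of_power[of "u * u' / of_nat D" 2] algebraic_int_mult[OF Suc.prems(5) u'2] by simp
  have cop: "coprime D (2 * (\<Prod>i<n. d i))" "coprime (2 * d n) D"
    using Suc.prems(4) by (auto simp: coprime_commute)
  have 2: "algebraic_int (2 * (u * u' / of_nat D))"
    using uu' by (intro algebraic_int_mult) auto
  have "algebraic_int ((u + u') / of_nat D)"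
  proof (rule Suc.IH)
    show "u + u' \<in> K n"
      using u subfield_Qbar_intros[OF F] by (simp add: u'_def F_def)
    have "(u + u') ^ 2 / of_nat D = u ^ 2 / of_nat D + u' ^ 2 / of_nat D + 2 * (u * u' / of_nat D)"
      by (simp add: power2_sum add_divide_distrib)
    then show "algebraic_int ((u + u') ^ 2 / of_nat D)"
      using Suc.prems(5) u'2 2 by (simp only: algebraic_int_add)
  qed (use Suc.prems int_u' cop in \<open>auto intro: algebraic_int_add\<close>)
  moreover have "algebraic_int ((u - u') * s n / of_nat D)"
  proof (rule Suc.IH)
    have "(u - u') * s n = 2 * b * (s n * s n)"
      using u by (simp add: u'_def algebra_simps)
    then have eq: "(u - u') * s n = 2 * b * of_nat (d n)"
      by (simp only: nat_sqrt_mult_self)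
    show "(u - u') * s n \<in> K n"
      unfolding eq F_def[symmetric] using u by (intro subfield_Qbar_intros[OF F])
    have "((u - u') * s n) ^ 2 / of_nat D =
        of_nat (d n) * (u ^ 2 / of_nat D + u' ^ 2 / of_nat D - 2 * (u * u' / of_nat D))"
      unfolding power_mult_distrib nat_sqrt_power2
      by (simp add: power2_diff add_divide_distrib diff_divide_distrib algebra_simps)
    then show "algebraic_int (((u - u') * s n) ^ 2 / of_nat D)"
      using Suc.prems(5) u'2 2 by (simp only: algebraic_int_add algebraic_int_diff algebraic_int_mult algebraic_int_of_nat)
  qed (use Suc.prems int_u' cop algebraic_int_nat_sqrt in \<open>auto intro: algebraic_int_diff algebraic_int_mult\<close>)
  \<comment> \<open>This makes 2 d n times u / D integral, and D times u / D is u. As 2 d n is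
    coprime to D, a Bezout identity gives u / D itself.\<close>
  moreover have "of_nat (2 * d n) * (u / of_nat D) =
      of_nat (d n) * ((u + u') / of_nat D) + ((u - u') * s n / of_nat D) * s n"
    using D by (simp add: field_simps nat_sqrt_mult_self)
  ultimately have *: "algebraic_int (of_nat (2 * d n) * (u / of_nat D))"
    using algebraic_int_nat_sqrt by (simp only: algebraic_int_add algebraic_int_mult algebraic_int_of_nat)
  have "algebraic_int (of_nat D * (u / of_nat D))"
    using D Suc.prems(2) by simp
  with cop(2) * show ?case by (rule algebraic_int_coprime_mult)
qed

lemma s_notin_K: "s n \<notin> K n"
proof
  assume "s n \<in> K n"
  then have "algebraic_int (s n / of_nat (d n))"
    using divides_of_divides_power2[of "s n" n "d n"] squarefree_d d_coprime_prefix d_gt_1[of n]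
    by (simp add: algebraic_int_nat_sqrt)
  then show False using nat_sqrt_not_divisible[OF d_gt_1] by simp
qed

end

section \<open>Norms and normality\<close>

lemma Rats_eq_range_to_ac: "\<rat> = range (to_ac :: rat \<Rightarrow> qbar)"
proof (intro equalityI subsetI)
  fix x :: qbar assume "x \<in> \<rat>"
  then obtain a b where "x = of_int a / of_int b" by (auto elim: Rats_cases')
  then have "x = to_ac (of_int a / of_int b)" by simp
  then show "x \<in> range to_ac" by blast
next
  fix x :: qbar assume "x \<in> range to_ac"
  then obtain q :: rat where q: "x = to_ac q" by blast
  have "q = of_int (fst (quotient_of q)) / of_int (snd (quotient_of q))"
    by (simp add: quotient_of_div)
  then have "x = of_int (fst (quotient_of q)) / of_int (snd (quotient_of q))"
    by (metis q to_ac_divide to_ac_of_int)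
  then show "x \<in> \<rat>" by simp
qed

section \<open>Polynomials over a subfield and products over conjugates\<close>

definition poly_over :: "qbar set \<Rightarrow> qbar poly \<Rightarrow> bool" where
  "poly_over F p \<longleftrightarrow> (\<forall>i. poly.coeff p i \<in> F)"

lemma poly_over_Rats:
  assumes "poly_over \<rat> f" obtains g :: "rat poly" where "f = map_poly to_ac g"
proof
  show "f = map_poly to_ac (map_poly of_ac f)"
    using assms by (intro poly_eqI) (auto simp: poly_over_def coeff_map_poly Rats_eq_range_to_ac to_ac_of_ac)
qed

context
  fixes F assumes F: "subfield F Qbar"
begin

lemma poly_over_mult: "poly_over F p \<Longrightarrow> poly_over F q \<Longrightarrow> poly_over F (p * q)"
  by (auto simp: poly_over_def coeff_mult intro!: subfield_Qbar_intros[OF F])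

lemma poly_over_diff: "poly_over F p \<Longrightarrow> poly_over F q \<Longrightarrow> poly_over F (p - q)"
  by (auto simp: poly_over_def intro!: subfield_Qbar_intros[OF F])

lemma poly_over_smult: "c \<in> F \<Longrightarrow> poly_over F p \<Longrightarrow> poly_over F (Polynomial.smult c p)"
  by (auto simp: poly_over_def intro!: subfield_Qbar_intros[OF F])

context
  fixes K \<sigma> assumes \<sigma>: "\<sigma> \<in> embeddings K F"
begin

lemma map_poly_embedding_mult:
  assumes "poly_over F p" "poly_over F q"
  shows "map_poly \<sigma> (p * q) = map_poly \<sigma> p * map_poly \<sigma> q"
  using assms
  by (intro poly_eqI)
    (simp add: coeff_map_poly coeff_mult embeddings_basic[OF \<sigma> F] embeddings_sum[OF \<sigma> F] poly_over_def
      subfield_Qbar_intros[OF F])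

lemma map_poly_embedding_diff:
  assumes "poly_over F p" "poly_over F q"
  shows "map_poly \<sigma> (p - q) = map_poly \<sigma> p - map_poly \<sigma> q"
  using assms by (intro poly_eqI) (simp add: coeff_map_poly embeddings_basic[OF \<sigma> F] poly_over_def)

lemma map_poly_embedding_smult:
  assumes "c \<in> F" "poly_over F p"
  shows "map_poly \<sigma> (Polynomial.smult c p) = Polynomial.smult (\<sigma> c) (map_poly \<sigma> p)"
  using assms by (intro poly_eqI) (simp add: coeff_map_poly embeddings_basic[OF \<sigma> F] poly_over_def)

end
end

interpretation to_ac_hom: comm_ring_hom "to_ac :: rat \<Rightarrow> qbar"
  by unfold_locales auto

interpretation map_poly_to_ac: map_poly_comm_ring_hom "to_ac :: rat \<Rightarrow> qbar" ..

text \<open>If p and g were coprime, evaluating a Bezout identity at the common root x would give 0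
  = 1.\<close>

lemma irreducible_rat_poly_dvd:
  fixes p g :: "rat poly" and x :: qbar
  assumes "irreducible p" "poly (map_poly to_ac p) x = 0" "poly (map_poly to_ac g) x = 0"
  shows "p dvd g"
proof (rule ccontr)
  assume "\<not> p dvd g"
  with assms(1) have "coprime p g"
    by (intro prime_elem_imp_coprime) (auto simp: prime_elem_iff_irreducible)
  then obtain a b where "a * p + b * g = 1"
    by (metis bezout_coefficients_fst_snd coprime_imp_gcd_eq_1)
  then have "map_poly to_ac (a * p + b * g) = (1 :: qbar poly)" by simp
  then have "poly (map_poly to_ac a * map_poly to_ac p + map_poly to_ac b * map_poly to_ac g) x = 1"
    by (simp only: map_poly_to_ac.hom_add map_poly_to_ac.hom_mult) simp
  then show False using assms by simp
qed

context multiquad_tower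
begin

lemma K_Suc: "K (Suc n) = quad_ext (K n) (s n)" by simp

lemmas quad_facts = subfield_multiquad[of d] s2_in_K s_notin_K

lemma K_strict_mono: "K n \<subset> K (Suc n)"
  using quad_ext_psubset[OF quad_facts] by simp

lemma dimension_K_step: "Qbar.dimension 2 (K n) (K (Suc n))"
  using dimension_quad_ext[OF quad_facts] by simp

lemma dimension_K: "Qbar.dimension (2 ^ n) \<rat> (K n)"
proof (induction n)
  case 0
  then show ?case using Qbar.dimension_one[OF subfield_Rats] by simp
next
  case (Suc n)
  show ?case
    using Qbar.telescopic_base[OF subfield_Rats subfield_multiquad Suc dimension_K_step] by (simp add: mult.commute)
qed

lemma number_field_K: "number_field (K n)"
  unfolding number_field_def
  using subfield_multiquad Qbar.finite_dimensionI[OF dimension_K] by blast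

lemma ext_degree_K: "ext_degree \<rat> (K n) = 2 ^ n" "ext_degree (K n) (K (Suc n)) = 2"
  using Qbar.dimI[OF subfield_Rats dimension_K] Qbar.dimI[OF subfield_multiquad dimension_K_step]
  by (simp_all add: over_def)

lemma s2_Rats: "s n ^ 2 \<in> \<rat>" by simp

lemmas embeddings_step =
  quad_facts subfield_Rats subfield_Qbar_Rats[OF subfield_multiquad] s2_Rats

lemma card_embeddings_K: "card (embeddings \<rat> (K n)) = 2 ^ n"
proof (induction n)
  case 0
  then show ?case using embeddings_self[OF subfield_Rats] by simp
next
  case (Suc n)
  then show ?case using card_embeddings_quad_ext[OF embeddings_step] by simp
qed

lemma finite_embeddings_K: "finite (embeddings \<rat> (K n))"
  by (rule card_ge_0_finite) (simp add: card_embeddings_K)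

text \<open>Every embedding only changes signs of the adjoined roots, so its values stay inside
  \<open>K n\<close>; normality is obtained from this.\<close>

lemma embeddings_K_image:
  assumes "\<sigma> \<in> embeddings \<rat> (K n)" "x \<in> K n" shows "\<sigma> x \<in> K n"
  using assms
proof (induction n arbitrary: \<sigma> x)
  case 0
  then show ?case using embeddings_self[OF subfield_Rats] by simp
next
  case (Suc n)
  from Suc.prems(1) obtain \<tau> t where \<tau>: "\<tau> \<in> embeddings \<rat> (K n)" "t = s n \<or> t = - s n"
      "\<sigma> = quad_lift (K n) (s n) \<tau> t"
    unfolding K_Suc embeddings_quad_ext[OF embeddings_step] by auto
  obtain a b where ab: "a \<in> K n" "b \<in> K n" "x = a + b * s n"
    using Suc.prems(2) unfolding K_Suc by (rule quad_extE)
  have "\<sigma> x = \<tau> a + \<tau> b * s n \<or> \<sigma> x = \<tau> a + (- \<tau> b) * s n"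
    using \<tau> ab by (auto simp: quad_lift_eq[OF quad_facts])
  moreover have *: "\<tau> a \<in> K n" "\<tau> b \<in> K n" "- \<tau> b \<in> K n"
    using Suc.IH[OF \<tau>(1)] ab(1,2) subfield_Qbar_closed(5)[OF subfield_multiquad] by auto
  ultimately show ?case
    unfolding K_Suc using quad_extI[OF *(1,2), of "s n"] quad_extI[OF *(1,3), of "s n"] by metis
qed

text \<open>For f = g + s h with g and h over \<open>K n\<close>, the factors for the two lifts of
  \<open>\<tau>\<close> multiply to \<open>\<tau>\<close> applied to g^2 - d h^2, which is again
  over \<open>K n\<close>; induction descends to \<rat>. Linear f will give normality, constant f
  the rationality of norms.\<close>

lemma prod_embeddings_poly_rational:
  assumes "poly_over (K n) f"
  shows "poly_over \<rat> (\<Prod>\<sigma>\<in>embeddings \<rat> (K n). map_poly \<sigma> f)"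
  using assms
proof (induction n arbitrary: f)
  case 0
  then have "map_poly (\<lambda>x\<in>\<rat>. x) f = f"
    by (intro poly_eqI) (auto simp: coeff_map_poly poly_over_def)
  with 0 show ?case
    by (simp only: multiquad.simps embeddings_self[OF subfield_Rats] prod.insert finite.emptyI
        prod.empty mult_1_right empty_iff not_False_eq_True)
next
  case (Suc n)
  have "\<forall>x\<in>K (Suc n). \<exists>a b. a \<in> K n \<and> b \<in> K n \<and> x = a + b * s n"
    unfolding K_Suc by (meson quad_extE)
  then obtain re im where re_im:
      "\<And>x. x \<in> K (Suc n) \<Longrightarrow> re x \<in> K n \<and> im x \<in> K n \<and> x = re x + im x * s n"
    by metis
  note c = subfield_Qbar_closed[OF subfield_multiquad]
  \<comment> \<open>\<open>re\<close> and \<open>im\<close> were merely chosen. Reading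
    \<open>map_poly\<close> coefficientwise needs them to vanish at 0, which uniqueness of the
    coordinates supplies.\<close>
  have 0: "re 0 = 0" "im 0 = 0"
    using re_im[OF c(2)] quad_ext_unique[OF quad_facts, of "re 0" n "im 0" 0 0] c(2)[of d n] by simp_all
  define g h where "g = map_poly re f" and "h = map_poly im f"
  have g: "poly_over (K n) g" and h: "poly_over (K n) h"
    using Suc.prems re_im by (auto simp: poly_over_def g_def h_def coeff_map_poly 0)
  define f' where "f' = g * g - Polynomial.smult (of_nat (d n)) (h * h)"
  have dn: "of_nat (d n) \<in> K n" by (rule subfield_Qbar_of_nat[OF subfield_multiquad])
  have f': "poly_over (K n) f'"
    unfolding f'_def using g h dn
    by (intro poly_over_diff poly_over_mult poly_over_smult subfield_multiquad)
  have lift: "map_poly (quad_lift (K n) (s n) \<tau> t) f = map_poly \<tau> g + Polynomial.smult t (map_poly \<tau> h)"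
    if "\<tau> \<in> embeddings \<rat> (K n)" "t = s n \<or> t = - s n" for \<tau> t
  proof (rule poly_eqI)
    fix i
    note \<tau>0 = embeddings_basic(4)[OF that(1) subfield_multiquad]
    have "quad_lift (K n) (s n) \<tau> t 0 = 0"
      using quad_lift_base[OF quad_facts] c(2) \<tau>0 by simp
    moreover have "quad_lift (K n) (s n) \<tau> t (poly.coeff f i) =
        \<tau> (re (poly.coeff f i)) + \<tau> (im (poly.coeff f i)) * t"
      using re_im[of "poly.coeff f i"] Suc.prems quad_lift_eq[OF quad_facts]
      unfolding poly_over_def by metis
    ultimately show "poly.coeff (map_poly (quad_lift (K n) (s n) \<tau> t) f) i =
        poly.coeff (map_poly \<tau> g + Polynomial.smult t (map_poly \<tau> h)) i"
      using \<tau>0 0 by (simp add: coeff_map_poly g_def h_def mult.commute)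
  qed
  have "map_poly (quad_lift (K n) (s n) \<tau> (s n)) f * map_poly (quad_lift (K n) (s n) \<tau> (- s n)) f =
      map_poly \<tau> f'" if \<tau>: "\<tau> \<in> embeddings \<rat> (K n)" for \<tau>
  proof -
    note \<tau>K = subfield_multiquad \<tau>
    have "map_poly \<tau> f' = map_poly \<tau> g * map_poly \<tau> g -
        Polynomial.smult (of_nat (d n)) (map_poly \<tau> h * map_poly \<tau> h)"
      using g h dn embeddings_of_int[OF \<tau> subfield_multiquad, of "int (d n)"]
      unfolding f'_def
      by (simp add: map_poly_embedding_diff[OF \<tau>K] map_poly_embedding_mult[OF \<tau>K]
          map_poly_embedding_smult[OF \<tau>K] poly_over_mult[OF subfield_multiquad]
          poly_over_smult[OF subfield_multiquad])
    also have "\<dots> = (map_poly \<tau> g + Polynomial.smult (s n) (map_poly \<tau> h)) *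
        (map_poly \<tau> g + Polynomial.smult (- s n) (map_poly \<tau> h))"
      by (simp add: algebra_simps nat_sqrt_mult_self)
    finally show ?thesis using lift[OF \<tau>] by simp
  qed
  then have "(\<Prod>\<sigma>\<in>embeddings \<rat> (K (Suc n)). map_poly \<sigma> f) = (\<Prod>\<tau>\<in>embeddings \<rat> (K n). map_poly \<tau> f')"
    unfolding K_Suc prod_embeddings_quad_ext[OF embeddings_step] by (intro prod.cong) auto
  then show ?case using Suc.IH[OF f'] by simp
qed

text \<open>The product of all X - \<open>\<sigma> x\<close> is rational and vanishes at x, since
  the identity is one of the embeddings. Hence p divides it, and every root of p is some
  \<open>\<sigma> x\<close>.\<close>

lemma conjugate_in_K:
  fixes p :: "rat poly"
  assumes "irreducible p" "poly (map_poly to_ac p) x = 0" "x \<in> K n" "poly (map_poly to_ac p) y = 0"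
  shows "y \<in> K n"
proof -
  note c = subfield_Qbar_closed[OF subfield_multiquad[of d n]]
  have "poly_over (K n) [:- x, 1:]"
    using assms(3) c by (auto simp: poly_over_def coeff_pCons split: nat.splits)
  then have "poly_over \<rat> (\<Prod>\<sigma>\<in>embeddings \<rat> (K n). map_poly \<sigma> [:- x, 1:])"
    by (rule prod_embeddings_poly_rational)
  then obtain g :: "rat poly" where g: "map_poly to_ac g = (\<Prod>\<sigma>\<in>embeddings \<rat> (K n). map_poly \<sigma> [:- x, 1:])"
    by (metis poly_over_Rats)
  have lin: "map_poly \<sigma> [:- x, 1:] = [:- \<sigma> x, 1:]" if "\<sigma> \<in> embeddings \<rat> (K n)" for \<sigma>
    using embeddings_basic[OF that subfield_multiquad] assms(3) by (simp add: map_poly_pCons)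
  have "map_poly to_ac g = (\<Prod>\<sigma>\<in>embeddings \<rat> (K n). [:- \<sigma> x, 1:])"
    unfolding g using lin by (rule prod.cong[OF refl])
  then have root_iff: "poly (map_poly to_ac g) z = 0 \<longleftrightarrow> (\<exists>\<sigma>\<in>embeddings \<rat> (K n). z = \<sigma> x)" for z
    using finite_embeddings_K[of n] by (auto simp: poly_prod)
  have "(\<lambda>x\<in>K n. x) \<in> embeddings \<rat> (K n)"
    using c subfield_Qbar_Rats[OF subfield_multiquad, of d n] by (auto simp: embeddings_iff)
  then have "poly (map_poly to_ac g) x = 0"
    using root_iff assms(3) by force
  then have "p dvd g" using irreducible_rat_poly_dvd assms(1,2) by blast
  then have "poly (map_poly to_ac g) y = 0"
    using assms(4) by (auto simp: map_poly_to_ac.hom_mult elim!: dvdE)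
  then obtain \<sigma> where "\<sigma> \<in> embeddings \<rat> (K n)" "y = \<sigma> x"
    using root_iff[of y] by blast
  then show ?thesis using embeddings_K_image[of \<sigma> n x] assms(3) by simp
qed

text \<open>Rationality comes from the product over conjugates of the constant polynomial x; a
  rational algebraic integer is an integer.\<close>

lemma rel_norm_Ints:
  assumes "x \<in> K n" "algebraic_int x" shows "rel_norm \<rat> (K n) x \<in> \<int>"
proof (rule rational_algebraic_int_is_int)
  show "algebraic_int (rel_norm \<rat> (K n) x)"
    unfolding rel_norm_def
    using assms embeddings_algebraic_int subfield_multiquad by (intro algebraic_int_prod) blast
  have "poly_over (K n) [:x:]"
    using assms(1) subfield_Qbar_closed[OF subfield_multiquad]
    by (auto simp: poly_over_def coeff_pCons split: nat.splits)
  then have "poly_over \<rat> (\<Prod>\<sigma>\<in>embeddings \<rat> (K n). map_poly \<sigma> [:x:])"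
    by (rule prod_embeddings_poly_rational)
  also have "(\<Prod>\<sigma>\<in>embeddings \<rat> (K n). map_poly \<sigma> [:x:]) = (\<Prod>\<sigma>\<in>embeddings \<rat> (K n). [:\<sigma> x:])"
  proof (rule prod.cong[OF refl])
    fix \<sigma> assume "\<sigma> \<in> embeddings \<rat> (K n)"
    from embeddings_basic(4)[OF this subfield_multiquad] show "map_poly \<sigma> [:x:] = [:\<sigma> x:]"
      by (intro poly_eqI) (auto simp: coeff_map_poly coeff_pCons split: nat.splits)
  qed
  also have "\<dots> = [:rel_norm \<rat> (K n) x:]"
    unfolding rel_norm_def by (induction rule: infinite_finite_induct) (auto simp: one_pCons)
  finally show "rel_norm \<rat> (K n) x \<in> \<rat>"
    by (auto simp: poly_over_def dest: spec[of _ 0])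
qed

lemma galois_ext_K: "galois_ext (K n)"
  unfolding galois_ext_def
proof (intro conjI allI impI subfield_multiquad)
  fix p :: "rat poly" and y
  assume "irreducible p" "\<exists>x\<in>K n. poly (map_poly to_ac p) x = 0" "poly (map_poly to_ac p) y = 0"
  then show "y \<in> K n" using conjugate_in_K[of p _ n y] by auto
qed

end

section \<open>Relative discriminants\<close>

lemma det_mat_2:
  fixes f :: "nat \<times> nat \<Rightarrow> 'a::comm_ring_1"
  shows "Determinant.det (Matrix.mat 2 2 f) = f (0, 0) * f (1, 1) - f (0, 1) * f (1, 0)"
proof -
  have "Determinant.det (Matrix.mat 2 2 f) =
      (\<Sum>j<2. Matrix.mat 2 2 f $$ (0, j) * cofactor (Matrix.mat 2 2 f) 0 j)"
    by (rule laplace_expansion_row) auto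
  also have "\<dots> = f (0, 0) * cofactor (Matrix.mat 2 2 f) 0 0 + f (0, 1) * cofactor (Matrix.mat 2 2 f) 0 1"
    by (simp add: numeral_2_eq_2)
  also have "cofactor (Matrix.mat 2 2 f) 0 0 = f (1, 1)"
    by (simp add: cofactor_def mat_delete_def det_single)
  also have "cofactor (Matrix.mat 2 2 f) 0 1 = - f (1, 0)"
    by (simp add: cofactor_def mat_delete_def det_single)
  finally show ?thesis by simp
qed

text \<open>\<open>ideal_norm\<close> is a definite description, so a positive generator must be
  exhibited before its value can be used. The least positive element of I is one, by division with
  remainder.\<close>

lemma int_ideal_principal:
  assumes I: "ideal I \<Z>" and x: "x \<in> I" "x \<noteq> 0"
  obtains n :: nat where "n > 0" "Idl\<^bsub>\<Z>\<^esub> {int n} = I"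
proof -
  interpret I: ideal I \<Z> by (rule I)
  have mult: "k * y \<in> I" if "y \<in> I" for k y using I.I_l_closed[OF that, of k] by simp
  have add: "y + z \<in> I" if "y \<in> I" "z \<in> I" for y z using I.a_closed[OF that] by simp
  define P where "P n \<longleftrightarrow> n > 0 \<and> int n \<in> I" for n
  have "int (nat \<bar>x\<bar>) \<in> I"
    using x(1) mult[OF x(1), of "- 1"] by (cases "x \<ge> 0") auto
  then have "P (nat \<bar>x\<bar>)" using x(2) by (simp add: P_def)
  then have n: "P (LEAST n. P n)" by (rule LeastI)
  define n where "n = (LEAST n. P n)"
  have "y \<in> Idl\<^bsub>\<Z>\<^esub> {int n}" if y: "y \<in> I" for y
  proof -
    have "y mod int n = y + (- (y div int n)) * int n" by (simp add: minus_div_mult_eq_mod[symmetric])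
    also have "\<dots> \<in> I" using n y add mult by (simp only: P_def n_def)
    finally have "int (nat (y mod int n)) \<in> I" using n by (simp add: P_def n_def)
    moreover have "nat (y mod int n) < n" using n by (simp add: P_def n_def nat_less_iff)
    ultimately have "nat (y mod int n) = 0"
      using not_less_Least[of "nat (y mod int n)" P] unfolding n_def P_def by auto
    then have "y mod int n \<le> 0" by simp
    then have "int n dvd y" using n by (metis P_def n_def dvd_eq_mod_eq_0 nle_le of_nat_0_less_iff pos_mod_sign)
    then show ?thesis by (auto simp: int_Idl elim!: dvdE intro: mult.commute)
  qed
  moreover have "Idl\<^bsub>\<Z>\<^esub> {int n} \<subseteq> I"
    using n by (intro int.genideal_minimal I) (simp add: P_def n_def)
  ultimately show ?thesis
    using that[of n] n by (auto simp: P_def n_def)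
qed

lemma subring_integers:
  assumes "subfield K Qbar" shows "subring {x \<in> K. algebraic_int x} Qbar"
  using subfield_Qbar_closed[OF assms]
  by (intro Qbar.subringI) (auto intro: algebraic_int_add algebraic_int_mult)

lemma ring_integers_of:
  assumes "subfield K Qbar" shows "ring (integers_of K)"
  using Qbar.subring_is_ring[OF subring_integers[OF assms]] .

lemma ideal_integersI:
  assumes K: "subfield K Qbar" and J: "J \<subseteq> {x \<in> K. algebraic_int x}" "0 \<in> J"
    and add: "\<And>x y. x \<in> J \<Longrightarrow> y \<in> J \<Longrightarrow> x + y \<in> J"
    and mult: "\<And>r x. r \<in> K \<Longrightarrow> algebraic_int r \<Longrightarrow> x \<in> J \<Longrightarrow> r * x \<in> J"
  shows "ideal J (integers_of K)"
proof -
  interpret R: ring "integers_of K" by (rule ring_integers_of[OF K])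
  have neg: "- x \<in> J" if "x \<in> J" for x
    using mult[of "- 1" x] that subfield_Qbar_closed[OF K] by auto
  show ?thesis
  proof (rule idealI[OF R.ring_axioms])
    show "subgroup J (add_monoid (integers_of K))"
    proof (rule subgroup.intro)
      fix x assume x: "x \<in> J"
      have "inv\<^bsub>add_monoid (integers_of K)\<^esub> x = - x"
        using R.minus_equality[of "- x" x] neg[OF x] x J by (auto simp: a_inv_def)
      then show "inv\<^bsub>add_monoid (integers_of K)\<^esub> x \<in> J" using neg[OF x] by simp
    qed (use J add in auto)
  next
    fix a x assume "a \<in> J" "x \<in> carrier (integers_of K)"
    then have "x * a \<in> J" using mult by simp
    then show "x \<otimes>\<^bsub>integers_of K\<^esub> a \<in> J" "a \<otimes>\<^bsub>integers_of K\<^esub> x \<in> J"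
      by (simp_all add: mult.commute)
  qed
qed

context
  fixes F s assumes F: "subfield F Qbar" and s2: "s ^ 2 \<in> F" and s: "s \<notin> F"
begin

lemma rel_trace_quad_ext:
  assumes "a \<in> F" "b \<in> F" shows "rel_trace F (quad_ext F s) (a + b * s) = 2 * a"
proof -
  have "rel_trace F (quad_ext F s) x =
      quad_lift F s (\<lambda>x\<in>F. x) s x + quad_lift F s (\<lambda>x\<in>F. x) (- s) x" for x
    unfolding rel_trace_def sum_embeddings_quad_ext[OF F s2 s F subset_refl s2] embeddings_self[OF F]
    by (simp only: sum.insert finite.emptyI sum.empty add_0_right empty_iff not_False_eq_True)
  then show ?thesis
    using assms by (simp add: quad_lift_eq[OF F s2 s])
qed

text \<open>The basis 1, s has discriminant 4 s^2, and a change of basis multiplies it by the square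
  of its determinant a b' - a' b.\<close>

lemma basis_disc_quad_ext:
  assumes "a \<in> F" "b \<in> F" "a' \<in> F" "b' \<in> F"
  shows "basis_disc F (quad_ext F s) [a + b * s, a' + b' * s] = s ^ 2 * (2 * (a * b' - a' * b)) ^ 2"
proof -
  note c = subfield_Qbar_closed[OF F]
  have tr: "rel_trace F (quad_ext F s) ((x + y * s) * (x' + y' * s)) = 2 * (x * x' + y * y' * s ^ 2)"
    if "x \<in> F" "y \<in> F" "x' \<in> F" "y' \<in> F" for x y x' y'
    unfolding quad_ext_mult[OF F s2] using that c s2 by (intro rel_trace_quad_ext) auto
  show ?thesis
    unfolding basis_disc_def using assms
    by (simp add: det_mat_2 tr numeral_2_eq_2[symmetric]) (simp add: algebra_simps power2_eq_square)
qed

end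

context multiquad_tower
begin

text \<open>The discriminant is \<open>d e\<^sup>2\<close> for some \<open>e\<close> in \<open>K n\<close> such that \<open>e \<surd>d\<close> is integral; as \<open>d\<close> is
  squarefree and coprime to the earlier radicands, \<open>e\<close> itself is integral.\<close>

lemma integral_basis_disc:
  assumes "set bs \<subseteq> carrier (integers_of (K (Suc n)))" "Qbar.independent (K n) bs"
    "Qbar.Span (K n) bs = K (Suc n)"
  shows "basis_disc (K n) (K (Suc n)) bs \<in> K n"
    "algebraic_int (basis_disc (K n) (K (Suc n)) bs / of_nat (d n))"
proof -
  have "Qbar.dimension (length bs) (K n) (K (Suc n))"
    using Qbar.dimensionI[OF subfield_multiquad assms(2,3)] .
  then have "length bs = 2"
    using Qbar.dimension_is_inj[OF subfield_multiquad _ dimension_K_step] by blast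
  then obtain x y where bs: "bs = [x, y]"
    by (auto simp: numeral_2_eq_2 length_Suc_conv)
  with assms(1) have xy: "x \<in> quad_ext (K n) (s n)" "y \<in> quad_ext (K n) (s n)"
      "algebraic_int x" "algebraic_int y"
    by auto
  obtain a b where ab: "a \<in> K n" "b \<in> K n" "x = a + b * s n" using xy(1) by (rule quad_extE)
  obtain a' b' where ab': "a' \<in> K n" "b' \<in> K n" "y = a' + b' * s n" using xy(2) by (rule quad_extE)
  define e where "e = 2 * (a * b' - a' * b)"
  have disc: "basis_disc (K n) (K (Suc n)) bs = of_nat (d n) * e ^ 2"
    unfolding bs ab(3) ab'(3) e_def K_Suc using basis_disc_quad_ext[OF quad_facts] ab ab' by simp
  have eK: "e \<in> K n"
    using ab ab' unfolding e_def by (intro subfield_Qbar_intros[OF subfield_multiquad])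
  have dn: "of_nat (d n) \<noteq> (0 :: qbar)" using d_gt_1[of n] by simp
  have int_conj: "algebraic_int (a - b * s n)" "algebraic_int (a' - b' * s n)"
    using quad_conjugate_algebraic_int[OF quad_facts] ab ab' xy by auto
  \<comment> \<open>Up to sign this is the determinant formed from x, y and their conjugates, whose
    square is the discriminant. It is integral although e is not yet known to be.\<close>
  have "e * s n = (a - b * s n) * y - (a' - b' * s n) * x"
    unfolding e_def ab ab' by (simp add: algebra_simps)
  then have es: "algebraic_int (e * s n)"
    using int_conj xy by (simp only: algebraic_int_diff algebraic_int_mult)
  have "algebraic_int (e * s n * s n)"
    using es algebraic_int_nat_sqrt by (rule algebraic_int_mult)
  then have de: "algebraic_int (of_nat (d n) * e)"
    unfolding mult.assoc nat_sqrt_mult_self by (simp add: mult.commute)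
  \<comment> \<open>The divisibility statement asks for an integral element, so it is applied to d e
    instead of e.\<close>
  have "(e * s n) ^ 2 = (of_nat (d n) * e) ^ 2 / of_nat (d n)"
    using dn by (simp add: power_mult_distrib) (simp add: power2_eq_square)
  then have "algebraic_int ((of_nat (d n) * e) ^ 2 / of_nat (d n))"
    using algebraic_int_power[OF es, of 2] by simp
  moreover have "of_nat (d n) * e \<in> K n"
    using eK by (intro subfield_Qbar_intros[OF subfield_multiquad])
  ultimately have "algebraic_int (of_nat (d n) * e / of_nat (d n))"
    using de squarefree_d d_coprime_prefix divides_of_divides_power2 by blast
  then have "algebraic_int e" using dn by simp
  then show "algebraic_int (basis_disc (K n) (K (Suc n)) bs / of_nat (d n))"
    unfolding disc using dn by (simp add: algebraic_int_power)
  show "basis_disc (K n) (K (Suc n)) bs \<in> K n"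
    unfolding disc using eK by (intro subfield_Qbar_intros[OF subfield_multiquad])
qed

text \<open>The principal ideal generated by \<open>d n\<close> in the integers of
  \<open>K n\<close>; integrality of x itself follows from that of the quotient.\<close>

definition disc_multiples :: "nat \<Rightarrow> qbar set" where
  "disc_multiples n = {x \<in> K n. algebraic_int (x / of_nat (d n))}"

lemma disc_multiplesE:
  assumes "x \<in> disc_multiples n"
  obtains y where "y \<in> K n" "algebraic_int y" "x = of_nat (d n) * y"
proof
  show "x / of_nat (d n) \<in> K n" "algebraic_int (x / of_nat (d n))"
    using assms by (auto simp: disc_multiples_def subfield_Qbar_intros[OF subfield_multiquad])
  show "x = of_nat (d n) * (x / of_nat (d n))" using d_gt_1[of n] by simp
qed

lemma ideal_disc_multiples: "ideal (disc_multiples n) (integers_of (K n))"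
proof (rule ideal_integersI[OF subfield_multiquad])
  show "disc_multiples n \<subseteq> {x \<in> K n. algebraic_int x}"
  proof
    fix x assume x: "x \<in> disc_multiples n"
    then obtain y where "y \<in> K n" "algebraic_int y" "x = of_nat (d n) * y"
      by (rule disc_multiplesE)
    then show "x \<in> {x \<in> K n. algebraic_int x}"
      using x by (simp add: disc_multiples_def algebraic_int_mult)
  qed
  show "0 \<in> disc_multiples n"
    by (simp add: disc_multiples_def subfield_Qbar_closed[OF subfield_multiquad])
  fix x assume x: "x \<in> disc_multiples n"
  show "x + y \<in> disc_multiples n" if "y \<in> disc_multiples n" for y
    using x that subfield_Qbar_closed(3)[OF subfield_multiquad]
    by (simp add: disc_multiples_def add_divide_distrib algebraic_int_add)
  show "r * x \<in> disc_multiples n" if "r \<in> K n" "algebraic_int r" for r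
    using x that subfield_Qbar_closed(4)[OF subfield_multiquad] algebraic_int_mult[of r "x / of_nat (d n)"]
    by (simp add: disc_multiples_def)
qed

lemma rel_discriminant_subset: "rel_discriminant (K n) (K (Suc n)) \<subseteq> disc_multiples n"
  unfolding rel_discriminant_def
proof (rule ring.genideal_minimal[OF ring_integers_of[OF subfield_multiquad] ideal_disc_multiples], clarify)
  fix bs assume "set bs \<subseteq> carrier (integers_of (K (Suc n)))" "Qbar.independent (K n) bs"
    "Qbar.Span (K n) bs = K (Suc n)"
  from integral_basis_disc[OF this] show "basis_disc (K n) (K (Suc n)) bs \<in> disc_multiples n"
    by (simp add: disc_multiples_def)
qed

text \<open>All 2^n embeddings fix \<open>d n\<close>, so the norm of \<open>d n\<close> times y is
  \<open>d n ^ 2 ^ n\<close> times the norm of y, which is an integer.\<close>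

lemma rel_norm_disc_multiple:
  assumes "x \<in> disc_multiples n" "of_int m = rel_norm \<rat> (K n) x"
  shows "int (d n) ^ 2 ^ n dvd m"
proof -
  obtain y where y: "y \<in> K n" "algebraic_int y" "x = of_nat (d n) * y"
    using assms(1) by (rule disc_multiplesE)
  obtain k where k: "rel_norm \<rat> (K n) y = of_int k"
    using rel_norm_Ints[OF y(1,2)] by (rule Ints_cases)
  have "rel_norm \<rat> (K n) x = (\<Prod>\<sigma>\<in>embeddings \<rat> (K n). of_nat (d n) * \<sigma> y)"
    unfolding rel_norm_def
  proof (rule prod.cong[OF refl])
    fix \<sigma> assume \<sigma>: "\<sigma> \<in> embeddings \<rat> (K n)"
    show "\<sigma> x = of_nat (d n) * \<sigma> y"
      using embeddings_basic(1)[OF \<sigma> subfield_multiquad _ y(1), of "of_nat (d n)"]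
        embeddings_of_int[OF \<sigma> subfield_multiquad, of "int (d n)"]
      by (simp add: y(3) subfield_Qbar_of_nat[OF subfield_multiquad])
  qed
  also have "\<dots> = of_nat (d n) ^ 2 ^ n * rel_norm \<rat> (K n) y"
    by (simp add: rel_norm_def prod.distrib card_embeddings_K)
  finally have "of_int m = (of_int (int (d n) ^ 2 ^ n * k) :: qbar)"
    using assms(2) k by simp
  then have "m = int (d n) ^ 2 ^ n * k" by (simp only: of_int_eq_iff)
  then show ?thesis by simp
qed

text \<open>The basis s n, 1 of integral elements has this discriminant. A nonzero element
  guarantees that the norm ideal is nonzero and so has a positive generator.\<close>

lemma disc_nonzero_element: "4 * of_nat (d n) \<in> rel_discriminant (K n) (K (Suc n))"
proof -
  note c = subfield_Qbar_closed[OF subfield_multiquad[of d n]]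
  interpret R: ring "integers_of (K n)" by (rule ring_integers_of[OF subfield_multiquad])
  have sub: "{basis_disc (K n) (K (Suc n)) bs |bs. set bs \<subseteq> carrier (integers_of (K (Suc n))) \<and>
      Qbar.independent (K n) bs \<and> Qbar.Span (K n) bs = K (Suc n)} \<subseteq> carrier (integers_of (K n))"
  proof clarify
    fix bs assume "set bs \<subseteq> carrier (integers_of (K (Suc n)))" "Qbar.independent (K n) bs"
      "Qbar.Span (K n) bs = K (Suc n)"
    from integral_basis_disc[OF this] have "basis_disc (K n) (K (Suc n)) bs \<in> disc_multiples n"
      by (simp add: disc_multiples_def)
    then show "basis_disc (K n) (K (Suc n)) bs \<in> carrier (integers_of (K n))"
      by (rule ideal.Icarr[OF ideal_disc_multiples])
  qed
  have disc: "basis_disc (K n) (K (Suc n)) [0 + 1 * s n, 1 + 0 * s n] = 4 * of_nat (d n)"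
    unfolding K_Suc using basis_disc_quad_ext[OF quad_facts, of 0 n 1 1 0] c(1,2) by simp
  have Span1: "Qbar.Span (K n) [1] = K n"
    by (auto simp: Qbar.line_extension_mem_iff)
  have "Qbar.independent (K n) [s n, 1]"
    using s_notin_K[of n] Span1 by (intro Qbar.li_Cons Qbar.li_Nil) auto
  moreover have "Qbar.Span (K n) [s n, 1] = K (Suc n)"
  proof -
    have "Qbar.Span (K n) [s n, 1] = Qbar.line_extension (K n) (s n) (K n)"
      using Span1 by simp
    also have "\<dots> = K (Suc n)"
      unfolding K_Suc quad_ext_def set_eq_iff Qbar.line_extension_mem_iff
      by (simp add: add.commute) (metis add.commute)
    finally show ?thesis .
  qed
  moreover have "set [s n, 1] \<subseteq> carrier (integers_of (K (Suc n)))"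
    using nat_sqrt_in_multiquad[of n "Suc n" d] subfield_Qbar_closed(1)[OF subfield_multiquad[of d "Suc n"]]
    by (auto simp: algebraic_int_nat_sqrt simp del: multiquad.simps)
  ultimately have "4 * of_nat (d n) \<in> {basis_disc (K n) (K (Suc n)) bs |bs.
      set bs \<subseteq> carrier (integers_of (K (Suc n))) \<and>
      Qbar.independent (K n) bs \<and> Qbar.Span (K n) bs = K (Suc n)}"
    using disc by (intro CollectI exI[of _ "[s n, 1]"]) auto
  then show ?thesis
    unfolding rel_discriminant_def using R.genideal_self[OF sub] by blast
qed

text \<open>Norms of elements of the discriminant are multiples of \<open>d n ^ 2 ^ n\<close>, so
  the whole norm ideal consists of such multiples. Its positive generator is one of them and hence
  at least as large.\<close>

lemma ideal_norm_ge: "d n ^ 2 ^ n \<le> ideal_norm (K n) (rel_discriminant (K n) (K (Suc n)))"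
proof -
  define S where "S = {m. \<exists>x\<in>rel_discriminant (K n) (K (Suc n)). of_int m = rel_norm \<rat> (K n) x}"
  define I where "I = norm_ideal (K n) (rel_discriminant (K n) (K (Suc n)))"
  have I: "I = Idl\<^bsub>\<Z>\<^esub> S" by (simp add: I_def norm_ideal_def S_def)
  have "S \<subseteq> Idl\<^bsub>\<Z>\<^esub> {int (d n) ^ 2 ^ n}"
    using rel_norm_disc_multiple rel_discriminant_subset
    by (fastforce simp: S_def int_Idl elim!: dvdE intro: mult.commute)
  then have sub: "I \<subseteq> Idl\<^bsub>\<Z>\<^esub> {int (d n) ^ 2 ^ n}"
    unfolding I by (intro int.genideal_minimal int.genideal_ideal) auto
  have "rel_norm \<rat> (K n) (4 * of_nat (d n)) = (\<Prod>\<sigma>\<in>embeddings \<rat> (K n). of_int (4 * int (d n)))"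
    unfolding rel_norm_def
  proof (rule prod.cong[OF refl])
    fix \<sigma> assume "\<sigma> \<in> embeddings \<rat> (K n)"
    from embeddings_of_int[OF this subfield_multiquad, of "4 * int (d n)"]
    show "\<sigma> (4 * of_nat (d n)) = of_int (4 * int (d n))" by simp
  qed
  also have "\<dots> = of_int ((4 * int (d n)) ^ 2 ^ n)" by (simp add: card_embeddings_K)
  finally have "(4 * int (d n)) ^ 2 ^ n \<in> S"
    unfolding S_def using disc_nonzero_element[of n] by (intro CollectI bexI) auto
  then have "(4 * int (d n)) ^ 2 ^ n \<in> I" unfolding I using int.genideal_self[of S] by auto
  moreover have "ideal I \<Z>" unfolding I by (rule int.genideal_ideal) auto
  moreover have "(4 * int (d n)) ^ 2 ^ n \<noteq> 0" using d_gt_1[of n] by simp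
  ultimately obtain k :: nat where k: "k > 0" "Idl\<^bsub>\<Z>\<^esub> {int k} = I"
    using int_ideal_principal by blast
  have "ideal_norm (K n) (rel_discriminant (K n) (K (Suc n))) = k"
    unfolding ideal_norm_def I_def[symmetric]
  proof (rule the_equality)
    show "0 < k \<and> Idl\<^bsub>\<Z>\<^esub> {int k} = I" using k by simp
    fix m assume "0 < m \<and> Idl\<^bsub>\<Z>\<^esub> {int m} = I"
    then have "Idl\<^bsub>\<Z>\<^esub> {int m} = Idl\<^bsub>\<Z>\<^esub> {int k}" using k by simp
    then show "m = k" unfolding Idl_eq_abs by simp
  qed
  moreover have "int (d n) ^ 2 ^ n dvd int k"
    using sub Idl_subset_eq_dvd unfolding k(2)[symmetric] by blast
  then have "d n ^ 2 ^ n dvd k"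
    by (simp flip: of_nat_power)
  ultimately show ?thesis using k(1) dvd_imp_le by simp
qed

end

section \<open>Abelian quadratic fields and the union of the tower\<close>

text \<open>An automorphism is determined by the sign it puts on s, and composition multiplies
  signs. So automorphisms commute and each is its own inverse.\<close>

lemma comm_group_galois_group_quad_ext:
  assumes s2: "s ^ 2 \<in> \<rat>" and s: "s \<notin> \<rat>"
  shows "comm_group (galois_group (quad_ext \<rat> s))"
proof -
  define M where "M = quad_ext \<rat> s"
  define G where "G = galois_group M"
  note M = subfield_quad_ext[OF subfield_Rats s2, folded M_def]
  note c = subfield_Qbar_closed[OF M]
  have carrier_G: "\<sigma> \<in> carrier G \<longleftrightarrow> \<sigma> \<in> embeddings \<rat> M \<and> bij_betw \<sigma> M M" for \<sigma>
    by (auto simp: G_def galois_group_def ring_iso_def Ring.ring_hom_def embeddings_iff bij_betw_def)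
  have mult_G: "\<sigma> \<otimes>\<^bsub>G\<^esub> \<tau> = compose M \<sigma> \<tau>" and one_G: "\<one>\<^bsub>G\<^esub> = (\<lambda>x\<in>M. x)" for \<sigma> \<tau>
    by (simp_all add: G_def galois_group_def)
  have sM: "s \<in> M" unfolding M_def by (rule root_in_quad_ext[OF subfield_Rats s2])
  have RM: "x \<in> M" if "x \<in> \<rat>" for x using subfield_Qbar_Rats[OF M] that by blast
  have root: "\<sigma> s = s \<or> \<sigma> s = - s" if "\<sigma> \<in> embeddings \<rat> M" for \<sigma>
  proof -
    note e = embeddings_basic[OF that M]
    have "\<sigma> s ^ 2 = s ^ 2"
      using e(1)[OF sM sM] e(7)[OF s2] by (simp add: power2_eq_square)
    then show ?thesis by (simp add: power2_eq_iff)
  qed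
  have form: "\<sigma> (a + b * s) = a + b * \<sigma> s" if "\<sigma> \<in> embeddings \<rat> M" "a \<in> \<rat>" "b \<in> \<rat>" for \<sigma> a b
    using embeddings_basic[OF that(1) M] that RM sM c(4) by simp
  have ext: "\<sigma> = \<tau>" if "\<sigma> \<in> embeddings \<rat> M" "\<tau> \<in> embeddings \<rat> M" "\<sigma> s = \<tau> s" for \<sigma> \<tau>
  proof (rule extensionalityI[of _ M])
    show "\<sigma> \<in> extensional M" "\<tau> \<in> extensional M" using that by (auto simp: embeddings_iff)
    fix x assume "x \<in> M"
    then obtain a b where "a \<in> \<rat>" "b \<in> \<rat>" "x = a + b * s" unfolding M_def by (rule quad_extE)
    then show "\<sigma> x = \<tau> x" using form[OF that(1)] form[OF that(2)] that(3) by metis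
  qed
  have closed: "compose M \<sigma> \<tau> \<in> carrier G" if "\<sigma> \<in> carrier G" "\<tau> \<in> carrier G" for \<sigma> \<tau>
  proof -
    have \<sigma>: "\<sigma> \<in> embeddings \<rat> M" "bij_betw \<sigma> M M" and \<tau>: "\<tau> \<in> embeddings \<rat> M" "bij_betw \<tau> M M"
      using that carrier_G by auto
    have "\<tau> x \<in> M" if "x \<in> M" for x using \<tau>(2) that by (auto simp: bij_betw_def)
    then have "compose M \<sigma> \<tau> \<in> embeddings \<rat> M"
      using \<sigma>(1) \<tau>(1) c(1,3,4) RM
      by (simp add: embeddings_iff compose_def)
    then show ?thesis using carrier_G bij_betw_compose[OF \<tau>(2) \<sigma>(2)] by simp
  qed
  have on_root: "compose M \<sigma> \<tau> s = (if \<sigma> s = \<tau> s then s else - s)"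
    if "\<sigma> \<in> carrier G" "\<tau> \<in> carrier G" for \<sigma> \<tau>
  proof -
    have \<sigma>: "\<sigma> \<in> embeddings \<rat> M" and \<tau>: "\<tau> \<in> embeddings \<rat> M" using that carrier_G by auto
    have "\<sigma> (- s) = - \<sigma> s" using embeddings_basic(5)[OF \<sigma> M sM] .
    then show ?thesis using root[OF \<sigma>] root[OF \<tau>] sM by (auto simp: compose_def)
  qed
  have one: "(\<lambda>x\<in>M. x) \<in> carrier G"
    unfolding carrier_G using RM c(1,3,4) by (auto simp: embeddings_iff bij_betw_def inj_on_def)
  have "comm_group G"
  proof (rule comm_groupI)
    fix \<sigma> \<tau> assume \<sigma>\<tau>: "\<sigma> \<in> carrier G" "\<tau> \<in> carrier G"
    show "\<sigma> \<otimes>\<^bsub>G\<^esub> \<tau> \<in> carrier G" using closed \<sigma>\<tau> by (simp add: mult_G)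
    show "\<sigma> \<otimes>\<^bsub>G\<^esub> \<tau> = \<tau> \<otimes>\<^bsub>G\<^esub> \<sigma>"
      unfolding mult_G
    proof (rule ext)
      show "compose M \<sigma> \<tau> s = compose M \<tau> \<sigma> s" using on_root \<sigma>\<tau> by simp
    qed (use closed \<sigma>\<tau> carrier_G in auto)
    fix \<rho> assume "\<rho> \<in> carrier G"
    show "\<sigma> \<otimes>\<^bsub>G\<^esub> \<tau> \<otimes>\<^bsub>G\<^esub> \<rho> = \<sigma> \<otimes>\<^bsub>G\<^esub> (\<tau> \<otimes>\<^bsub>G\<^esub> \<rho>)"
      unfolding mult_G using \<open>\<rho> \<in> carrier G\<close> carrier_G
      by (intro compose_assoc[symmetric]) (auto simp: bij_betw_def)
  next
    show "\<one>\<^bsub>G\<^esub> \<in> carrier G" using one by (simp add: one_G)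
    fix \<sigma> assume \<sigma>: "\<sigma> \<in> carrier G"
    then have \<sigma>M: "\<sigma> \<in> extensional M" "\<sigma> \<in> M \<rightarrow> M"
      using carrier_G by (auto simp: embeddings_iff bij_betw_def)
    show "\<one>\<^bsub>G\<^esub> \<otimes>\<^bsub>G\<^esub> \<sigma> = \<sigma>"
      unfolding mult_G one_G using \<sigma>M by (auto simp: compose_def restrict_def extensional_def fun_eq_iff)
    have "compose M \<sigma> \<sigma> = (\<lambda>x\<in>M. x)"
    proof (rule ext)
      show "compose M \<sigma> \<sigma> s = (\<lambda>x\<in>M. x) s" using on_root[OF \<sigma> \<sigma>] sM by simp
    qed (use closed[OF \<sigma> \<sigma>] one carrier_G in auto)
    then show "\<exists>\<tau>\<in>carrier G. \<tau> \<otimes>\<^bsub>G\<^esub> \<sigma> = \<one>\<^bsub>G\<^esub>"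
      unfolding mult_G one_G using \<sigma> by blast
  qed
  then show ?thesis by (simp add: G_def M_def)
qed

context multiquad_tower
begin

definition L :: "qbar set" where "L = (\<Union>n. K n)"

lemma K_subset_L: "K n \<subseteq> L"
  by (auto simp: L_def)

lemma L_common:
  assumes "x \<in> L" "y \<in> L" obtains n where "x \<in> K n" "y \<in> K n"
proof -
  obtain i j where "x \<in> K i" "y \<in> K j" using assms by (auto simp: L_def)
  then show ?thesis 
    using that[of "max i j"] multiquad_mono[of i "max i j" d] multiquad_mono[of j "max i j" d] by auto
qed

lemma subfield_L: "subfield L Qbar"
proof (rule subfield_QbarI)
  note c = subfield_Qbar_closed[OF subfield_multiquad[of d]]
  show "1 \<in> L" using c(1) K_subset_L by blast
  fix x assume x: "x \<in> L"
  show "x - y \<in> L" "x * y \<in> L" if y: "y \<in> L" for y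
  proof -
    obtain n where "x \<in> K n" "y \<in> K n" using x y by (rule L_common)
    then show "x - y \<in> L" "x * y \<in> L" using c(6)[of x n y] c(4)[of x n y] K_subset_L by auto
  qed
  show "inverse x \<in> L" using x c(7) by (auto simp: L_def)
qed

lemma galois_ext_L: "galois_ext L"
  unfolding galois_ext_def
proof (intro conjI allI impI subfield_L)
  fix p :: "rat poly" and y
  assume p: "irreducible p" "\<exists>x\<in>L. poly (map_poly to_ac p) x = 0" "poly (map_poly to_ac p) y = 0"
  then obtain n x where "x \<in> K n" "poly (map_poly to_ac p) x = 0" by (auto simp: L_def)
  then have "y \<in> K n" using conjugate_in_K[of p x n y] p by simp
  then show "y \<in> L" using K_subset_L by blast
qed

text \<open>If L had dimension m, its subfield \<open>K m\<close> would contribute 2^m > m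
  independent elements.\<close>

lemma infinite_ext_L: "\<not> finite_ext \<rat> L"
proof
  assume "finite_ext \<rat> L"
  then obtain m where m: "Qbar.dimension m \<rat> L" by (auto simp: Qbar.finite_dimension_def)
  obtain Us where Us: "Qbar.independent \<rat> Us" "length Us = 2 ^ m" "Qbar.Span \<rat> Us = K m"
    using Qbar.exists_base[OF subfield_Rats dimension_K] by blast
  have "set Us \<subseteq> L"
    using Qbar.Span_base_incl[OF subfield_Rats, of Us] Us(3) K_subset_L by auto
  then have "2 ^ m \<le> m"
    using Qbar.independent_length_le_dimension[OF subfield_Rats m Us(1)] Us(2) by simp
  then show False using less_exp[of m] by simp
qed

text \<open>Starting the radicands at index i makes \<rat>(s i) the first level of another tower, so
  its degree and normality come from the results on towers.\<close>

lemma quad_ext_subset_Q2ab: "quad_ext \<rat> (s i) \<subseteq> Q2ab"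
proof -
  interpret shift: multiquad_tower "\<lambda>j. d (i + j)"
    using squarefree_d d_gt_1 odd_d coprime_d by unfold_locales auto
  have K1: "multiquad (\<lambda>j. d (i + j)) 1 = quad_ext \<rat> (s i)" by simp
  have "number_field (quad_ext \<rat> (s i))" "galois_ext (quad_ext \<rat> (s i))" "ext_degree \<rat> (quad_ext \<rat> (s i)) = 2"
    using shift.number_field_K[of 1] shift.galois_ext_K[of 1] shift.ext_degree_K(1)[of 1] K1 by auto
  moreover have "comm_group (galois_group (quad_ext \<rat> (s i)))"
    using shift.s_notin_K[of 0] by (intro comm_group_galois_group_quad_ext) auto
  ultimately show ?thesis
    unfolding Q2ab_def by (intro subsetI generate_field.incl) auto
qed

lemma L_subset_Q2ab: "L \<subseteq> Q2ab"
proof -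
  have Q: "subfield Q2ab Qbar"
    unfolding Q2ab_def by (rule field.generate_field_is_subfield[OF field_Qbar]) simp
  have "K n \<subseteq> Q2ab" for n
  proof (induction n)
    case 0
    then show ?case using subfield_Qbar_Rats[OF Q] by simp
  next
    case (Suc n)
    have "s n \<in> Q2ab"
      using quad_ext_subset_Q2ab root_in_quad_ext[OF subfield_Rats s2_Rats] by blast
    with Suc show ?case
      unfolding K_Suc by (intro quad_ext_least[OF subfield_multiquad s2_in_K Q])
  qed
  then show ?thesis by (auto simp: L_def)
qed

end

section \<open>Primes that split completely\<close>

text \<open>Zorn's lemma on the ideals that contain I and omit 1; unions of nonempty chains keep
  both properties.\<close>

lemma ex_maximalideal:
  assumes R: "cring R" and I: "ideal I R" "\<one>\<^bsub>R\<^esub> \<notin> I"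
  obtains M where "maximalideal M R" "I \<subseteq> M"
proof -
  interpret R: cring R by (rule R)
  define A where "A = {J. ideal J R \<and> I \<subseteq> J \<and> \<one>\<^bsub>R\<^esub> \<notin> J}"
  have "A \<noteq> {}" using I by (auto simp: A_def)
  moreover have "\<Union>C \<in> A" if C: "C \<noteq> {}" "subset.chain A C" for C
  proof -
    have CA: "\<And>J. J \<in> C \<Longrightarrow> J \<in> A" and lin: "\<And>J J'. J \<in> C \<Longrightarrow> J' \<in> C \<Longrightarrow> J \<subseteq> J' \<or> J' \<subseteq> J"
      using C(2) by (auto simp: subset_chain_def)
    have sub: "additive_subgroup J R" if "J \<in> C" for J
      using CA[OF that] by (auto simp: A_def ideal_def)
    have "ideal (\<Union>C) R"
    proof (rule idealI[OF R.ring_axioms])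
      show "subgroup (\<Union>C) (add_monoid R)"
      proof (rule subgroup.intro)
        show "\<Union>C \<subseteq> carrier (add_monoid R)"
          using additive_subgroup.a_subset[OF sub] by fastforce
        show "\<one>\<^bsub>add_monoid R\<^esub> \<in> \<Union>C"
          using C(1) additive_subgroup.zero_closed[OF sub] by fastforce
        show "inv\<^bsub>add_monoid R\<^esub> x \<in> \<Union>C" if "x \<in> \<Union>C" for x
          using that additive_subgroup.a_inv_closed[OF sub] by (auto simp: a_inv_def)
        fix x y assume "x \<in> \<Union>C" "y \<in> \<Union>C"
        then obtain J J' where J: "J \<in> C" "J' \<in> C" "x \<in> J" "y \<in> J'" by blast
        then obtain J'' where "J'' \<in> C" "x \<in> J''" "y \<in> J''" using lin[OF J(1,2)] by blast
        then show "x \<otimes>\<^bsub>add_monoid R\<^esub> y \<in> \<Union>C"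
          using additive_subgroup.a_closed[OF sub] by auto
      qed
    next
      fix a x assume "a \<in> \<Union>C" "x \<in> carrier R"
      then obtain J where J: "J \<in> C" "a \<in> J" "ideal J R" using CA by (auto simp: A_def)
      then show "x \<otimes>\<^bsub>R\<^esub> a \<in> \<Union>C" "a \<otimes>\<^bsub>R\<^esub> x \<in> \<Union>C"
        using ideal.I_l_closed[OF J(3,2) \<open>x \<in> carrier R\<close>] ideal.I_r_closed[OF J(3,2) \<open>x \<in> carrier R\<close>]
        by auto
    qed
    then show ?thesis using C(1) CA by (auto simp: A_def)
  qed
  ultimately obtain M where M: "M \<in> A" "\<And>J. J \<in> A \<Longrightarrow> M \<subseteq> J \<Longrightarrow> J = M"
    using subset_Zorn_nonempty[of A] by metis
  have "maximalideal M R"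
  proof (rule maximalidealI)
    show "ideal M R" using M(1) by (simp add: A_def)
    show "carrier R \<noteq> M" using M(1) R.one_closed by (auto simp: A_def)
    fix J assume J: "ideal J R" "M \<subseteq> J" "J \<subseteq> carrier R"
    show "J = M \<or> J = carrier R"
    proof (cases "\<one>\<^bsub>R\<^esub> \<in> J")
      case True
      then show ?thesis using ideal.one_imp_carrier[OF J(1)] by simp
    next
      case False
      then have "J \<in> A" using J M(1) by (auto simp: A_def)
      then show ?thesis using M(2) J(2) by simp
    qed
  qed
  then show ?thesis using that M(1) by (auto simp: A_def)
qed

lemma cring_integers_of:
  assumes "subfield K Qbar" shows "cring (integers_of K)"
  by (intro cring.intro comm_monoid.intro ring_integers_of[OF assms] comm_monoid_axioms.intro
      ring.is_monoid[OF ring_integers_of[OF assms]]) auto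

text \<open>The multiples of p form a proper ideal because 1/p is not an algebraic integer.
  Nonemptiness makes the \<open>SOME\<close> in \<open>ram_index\<close> and
  \<open>inertia_degree\<close> pick a genuine prime.\<close>

lemma primes_above_nonempty:
  assumes K: "subfield K Qbar" and p: "p > 1"
  shows "primes_above K p \<noteq> {}"
proof -
  interpret R: cring "integers_of K" by (rule cring_integers_of[OF K])
  define I where "I = {x \<in> K. algebraic_int x \<and> algebraic_int (x / of_nat p)}"
  have pI: "of_nat p \<in> I" using p subfield_Qbar_of_nat[OF K] by (simp add: I_def)
  have "ideal I (integers_of K)"
  proof (rule ideal_integersI[OF K])
    fix r x assume "r \<in> K" "algebraic_int r" "x \<in> I"
    then show "r * x \<in> I"
      using subfield_Qbar_closed(4)[OF K] algebraic_int_mult[of r "x / of_nat p"] algebraic_int_mult[of r x]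
      by (simp add: I_def)
  next
    fix x y assume "x \<in> I" "y \<in> I"
    then show "x + y \<in> I"
      using subfield_Qbar_closed(3)[OF K] by (simp add: I_def add_divide_distrib algebraic_int_add)
  qed (use subfield_Qbar_closed(2)[OF K] in \<open>auto simp: I_def\<close>)
  moreover have "\<one>\<^bsub>integers_of K\<^esub> \<notin> I"
    using p algebraic_int_of_int_div_iff[of p 1, where 'a = qbar] by (simp add: I_def)
  ultimately obtain M where "maximalideal M (integers_of K)" "I \<subseteq> M"
    using ex_maximalideal[OF R.is_cring] by blast
  then show ?thesis
    using R.maximalideal_prime pI by (auto simp: primes_above_def)
qed

text \<open>The prime \<open>p\<close> splits completely in every \<open>K n\<close>, and \<open>P\<close> lies above it.\<close>

locale split_prime = multiquad_tower +
  fixes p :: nat and P :: "qbar set"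
  assumes prime_p: "prime p" and odd_p: "odd p"
    and quad_res: "\<And>i. \<not> p dvd d i \<and> (\<exists>r. int p dvd r ^ 2 - int (d i))"
    and P_above: "P \<in> primes_above L p"
begin

abbreviation "OL \<equiv> integers_of L"

lemma primeideal_P: "primeideal P OL" and p_in_P: "of_nat p \<in> P"
  using P_above by (auto simp: primes_above_def)

sublocale P: primeideal P OL by (rule primeideal_P)

lemma P_subset: "x \<in> P \<Longrightarrow> x \<in> L" "x \<in> P \<Longrightarrow> algebraic_int x"
  using P.Icarr by auto

lemma P_add: "x \<in> P \<Longrightarrow> y \<in> P \<Longrightarrow> x + y \<in> P"
  using additive_subgroup.a_closed[OF ideal.axioms(1)[OF P.ideal_axioms], of x y] by simp

lemma P_mult: "r \<in> L \<Longrightarrow> algebraic_int r \<Longrightarrow> x \<in> P \<Longrightarrow> r * x \<in> P"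
  using P.I_l_closed[of x r] by simp

lemma P_minus: "x \<in> P \<Longrightarrow> - x \<in> P"
  using P_mult[of "- 1" x] subfield_Qbar_closed[OF subfield_L] by auto

lemma P_diff: "x \<in> P \<Longrightarrow> y \<in> P \<Longrightarrow> x - y \<in> P"
  using P_add[of x "- y"] P_minus by simp

lemma P_of_int_mult: "x \<in> P \<Longrightarrow> of_int k * x \<in> P"
  by (rule P_mult) (auto intro: subfield_Qbar_of_int[OF subfield_L])

lemma P_prime:
  assumes "x \<in> L" "algebraic_int x" "y \<in> L" "algebraic_int y" "x * y \<in> P"
  shows "x \<in> P \<or> y \<in> P"
  using P.I_prime[of x y] assms by simp

lemma one_notin_P: "1 \<notin> P"
  using P.one_imp_carrier P.I_notcarr by auto

lemma p_pos: "p > 0"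
  using prime_p prime_gt_0_nat by simp

lemma of_int_in_P_iff: "of_int m \<in> P \<longleftrightarrow> int p dvd m"
proof
  assume m: "of_int m \<in> P"
  show "int p dvd m"
  proof (rule ccontr)
    assume "\<not> int p dvd m"
    then have "coprime (int p) m"
      using prime_p by (intro prime_imp_coprime) auto
    then obtain a b where "a * int p + b * m = 1"
      using bezout_int[of "int p" m] by auto
    then have "of_int a * of_nat p + of_int b * of_int m = (1 :: qbar)"
      by (metis of_int_1 of_int_add of_int_mult of_int_of_nat_eq)
    moreover have "of_int a * of_nat p + of_int b * of_int m \<in> P"
      by (intro P_add P_of_int_mult m p_in_P)
    ultimately show False using one_notin_P by simp
  qed
next
  assume "int p dvd m"
  then obtain k where "m = k * int p" by (metis dvd_div_mult_self)
  then show "of_int m \<in> P" using P_of_int_mult[OF p_in_P, of k] by simp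
qed

lemma s_in_L: "s i \<in> L"
  using nat_sqrt_in_multiquad[of i "Suc i" d] K_subset_L by blast

text \<open>The product of s - r and s + r is d - r^2, which lies in P, so one factor does; the sign
  of r is chosen to make it the first.\<close>

lemma ex_residue: "\<exists>r. int p dvd r ^ 2 - int (d i) \<and> \<not> int p dvd r \<and> s i - of_int r \<in> P"
proof -
  obtain r where r: "int p dvd r ^ 2 - int (d i)" using quad_res by blast
  have nr: "\<not> int p dvd r"
  proof
    assume "int p dvd r"
    then have "int p dvd r ^ 2" by (simp add: power2_eq_square)
    then have "int p dvd int (d i)" using r by (metis dvd_diff diff_diff_eq2 add_diff_cancel_left' dvd_diff_commute)
    then show False using quad_res by simp
  qed
  have "(s i - of_int r) * (s i - of_int (- r)) = of_int (int (d i) - r ^ 2)"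
    by (simp add: algebra_simps nat_sqrt_mult_self power2_eq_square)
  also have "\<dots> \<in> P" unfolding of_int_in_P_iff using r by (simp add: dvd_diff_commute)
  finally have "s i - of_int r \<in> P \<or> s i - of_int (- r) \<in> P"
    by (intro P_prime subfield_Qbar_closed(6)[OF subfield_L] subfield_Qbar_of_int[OF subfield_L] s_in_L
        algebraic_int_diff algebraic_int_nat_sqrt algebraic_int_of_int)
  then show ?thesis using r nr by (metis dvd_minus_iff power2_minus)
qed

definition res :: "nat \<Rightarrow> int" where
  "res i = (SOME r. int p dvd r ^ 2 - int (d i) \<and> \<not> int p dvd r \<and> s i - of_int r \<in> P)"

lemma res: "int p dvd res i ^ 2 - int (d i)" "\<not> int p dvd res i" "s i - of_int (res i) \<in> P"
  using someI_ex[OF ex_residue[of i]] unfolding res_def[symmetric] by auto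

text \<open>Modulo \<open>p\<close>, the element \<open>split n\<close> of \<open>K n\<close> is annihilated by \<open>P\<close> but does not lie in \<open>P\<close>.\<close>

definition split :: "nat \<Rightarrow> qbar" where
  "split n = (\<Prod>i<n. s i + of_int (res i))"

lemma split_Suc: "split (Suc n) = split n * (s n + of_int (res n))"
  by (simp add: split_def)

lemma algebraic_int_s_plus: "algebraic_int (s i + of_int (res i))"
  by (intro algebraic_int_add algebraic_int_nat_sqrt algebraic_int_of_int)

lemma algebraic_int_split: "algebraic_int (split n)"
  unfolding split_def by (intro algebraic_int_prod algebraic_int_s_plus)

lemma s_plus_in_L: "s i + of_int (res i) \<in> L"
  by (intro subfield_Qbar_closed(3)[OF subfield_L] subfield_Qbar_of_int[OF subfield_L] s_in_L)

lemma split_in_L: "split n \<in> L"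
  unfolding split_def by (intro subfield_Qbar_prod[OF subfield_L] s_plus_in_L)

text \<open>Modulo P each factor s + r is congruent to 2 r, which is nonzero as p is odd and does
  not divide r.\<close>

lemma split_notin_P: "split n \<notin> P"
proof (induction n)
  case 0
  then show ?case using one_notin_P by (simp add: split_def)
next
  case (Suc n)
  have "s n + of_int (res n) \<notin> P"
  proof
    assume "s n + of_int (res n) \<in> P"
    from P_diff[OF this res(3)[of n]] have "of_int (2 * res n) \<in> P" by simp
    then have "int p dvd 2 * res n" by (simp only: of_int_in_P_iff)
    then have "int p dvd 2" using res(2) prime_p by (metis prime_dvd_mult_iff prime_int_nat_transfer nat_int prime_nat_int_transfer)
    then have "p dvd 2" by (metis int_dvd_int_iff of_nat_numeral)
    then have "p = 2" using prime_p two_is_prime_nat primes_dvd_imp_eq by blast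
    then show False using odd_p by simp
  qed
  then show ?case
    unfolding split_Suc using Suc P_prime[OF split_in_L algebraic_int_split s_plus_in_L algebraic_int_s_plus] by blast
qed

text \<open>Divisibility of x times \<open>split n\<close> by p. As \<open>split n\<close> lies
  outside P, this says that x is a multiple of p locally at P; for all x in P it expresses that p is
  unramified there.\<close>

definition ann :: "nat \<Rightarrow> qbar \<Rightarrow> bool" where
  "ann n x \<longleftrightarrow> algebraic_int (x * split n / of_nat p)"

lemma ann_add: "ann n x \<Longrightarrow> ann n y \<Longrightarrow> ann n (x + y)"
  by (simp add: ann_def distrib_right add_divide_distrib algebraic_int_add)

lemma ann_mult: "algebraic_int r \<Longrightarrow> ann n x \<Longrightarrow> ann n (r * x)"
  using algebraic_int_mult[of r "x * split n / of_nat p"] by (simp add: ann_def mult.assoc)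

lemma ann_p: "ann n (of_nat p)"
  using p_pos algebraic_int_split by (simp add: ann_def)

lemma ann_Suc: "ann n x \<Longrightarrow> ann (Suc n) x"
  using algebraic_int_mult[OF _ algebraic_int_s_plus, of "x * split n / of_nat p" n]
  by (simp add: ann_def split_Suc mult_ac)

text \<open>The new factor s + r of \<open>split (Suc n)\<close> turns s - r into d - r^2, a
  multiple of p.\<close>

lemma ann_s: "ann (Suc n) (s n - of_int (res n))"
proof -
  obtain k where k: "res n ^ 2 - int (d n) = int p * k" using res(1) by (rule dvdE)
  have "(s n - of_int (res n)) * (s n + of_int (res n)) = - of_int (res n ^ 2 - int (d n))"
    by (simp add: algebra_simps nat_sqrt_mult_self power2_eq_square)
  then have "(s n - of_int (res n)) * (s n + of_int (res n)) = of_nat p * of_int (- k)"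
    unfolding k by simp
  then have "(s n - of_int (res n)) * split (Suc n) = of_nat p * (of_int (- k) * split n)"
    unfolding split_Suc by (metis mult.assoc mult.commute)
  then have "(s n - of_int (res n)) * split (Suc n) / of_nat p = of_int (- k) * split n"
    using p_pos by simp
  then show ?thesis
    unfolding ann_def using algebraic_int_mult[OF algebraic_int_of_int algebraic_int_split] by simp
qed

text \<open>The multiplier N absorbs denominators: the coordinates a and b of x need not be
  integral, but 2 a and 2 b d are. Membership in P will give the residue field and
  \<open>ann\<close> the ramification; both congruences need the same N and m, so one induction
  carries them.\<close>

lemma integer_residue:
  assumes "x \<in> K n" "algebraic_int x"
  shows "\<exists>N m. \<not> int p dvd N \<and> of_int N * x - of_int m \<in> P \<and> ann n (of_int N * x - of_int m)"
  using assms
proof (induction n arbitrary: x)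
  case 0
  then obtain k where "x = of_int k"
    using rational_algebraic_int_is_int by (auto elim: Ints_cases)
  moreover have "\<not> int p dvd 1" using prime_p by (simp add: prime_nat_iff zdvd1_eq)
  moreover have "0 \<in> P" using of_int_in_P_iff[of 0] by simp
  ultimately show ?case by (intro exI[of _ 1] exI[of _ k]) (auto simp: ann_def)
next
  case (Suc n)
  have dn: "of_nat (d n) = (of_int (int (d n)) :: qbar)" by simp
  obtain a b where ab: "a \<in> K n" "b \<in> K n" "x = a + b * s n"
    using Suc.prems(1) unfolding K_Suc by (rule quad_extE)
  define \<alpha> where "\<alpha> = 2 * a"
  define \<beta> where "\<beta> = 2 * b * of_nat (d n)"
  have \<alpha>\<beta>: "\<alpha> \<in> K n" "\<beta> \<in> K n"
    unfolding \<alpha>_def \<beta>_def using ab by (auto intro!: subfield_Qbar_intros[OF subfield_multiquad])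
  have conj: "algebraic_int (a - b * s n)"
    using quad_conjugate_algebraic_int[OF quad_facts ab(1,2)] Suc.prems(2) ab(3) by simp
  have "\<alpha> = x + (a - b * s n)" by (simp add: \<alpha>_def ab(3))
  then have int_\<alpha>: "algebraic_int \<alpha>" using Suc.prems(2) conj by (simp only: algebraic_int_add)
  have "\<beta> = (x - (a - b * s n)) * s n"
    by (simp add: \<beta>_def ab(3) nat_sqrt_mult_self[symmetric] algebra_simps)
  then have int_\<beta>: "algebraic_int \<beta>"
    using Suc.prems(2) conj by (simp only: algebraic_int_diff algebraic_int_mult algebraic_int_nat_sqrt)
  obtain N1 m1 where 1: "\<not> int p dvd N1" "of_int N1 * \<alpha> - of_int m1 \<in> P" "ann n (of_int N1 * \<alpha> - of_int m1)"
    using Suc.IH[OF \<alpha>\<beta>(1) int_\<alpha>] by blast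
  obtain N2 m2 where 2: "\<not> int p dvd N2" "of_int N2 * \<beta> - of_int m2 \<in> P" "ann n (of_int N2 * \<beta> - of_int m2)"
    using Suc.IH[OF \<alpha>\<beta>(2) int_\<beta>] by blast
  \<comment> \<open>Multiply 2 d x = d \<open>\<alpha>\<close> + \<open>\<beta>\<close> s by N1 N2;
    then m arises by putting m1, m2 and \<open>res n\<close> in place of N1 \<open>\<alpha>\<close>,
    N2 \<open>\<beta>\<close> and s.\<close>
  define N where "N = N1 * N2 * (2 * int (d n))"
  define m where "m = int (d n) * N2 * m1 + N1 * m2 * res n"
  have "\<not> int p dvd 2"
  proof
    assume "int p dvd 2"
    then have "p dvd 2" by (metis int_dvd_int_iff of_nat_numeral)
    then have "p = 2" using prime_p two_is_prime_nat primes_dvd_imp_eq by blast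
    then show False using odd_p by simp
  qed
  moreover have "prime (int p)" using prime_p by simp
  ultimately have "\<not> int p dvd N"
    unfolding N_def using 1(1) 2(1) quad_res[of n] by (auto simp: prime_dvd_mult_iff)
  have "of_int N * x = of_int (int (d n) * N2) * (of_int N1 * \<alpha>) + of_int N1 * (of_int N2 * \<beta>) * s n"
    by (simp add: N_def \<alpha>_def \<beta>_def ab(3) algebra_simps)
  then have eq: "of_int N * x - of_int m = of_int (int (d n) * N2) * (of_int N1 * \<alpha> - of_int m1)
      + (of_int N1 * s n) * (of_int N2 * \<beta> - of_int m2) + of_int (N1 * m2) * (s n - of_int (res n))"
    by (simp add: m_def algebra_simps)
  have N1s: "algebraic_int (of_int N1 * s n)" "of_int N1 * s n \<in> L"
    by (intro algebraic_int_mult algebraic_int_of_int algebraic_int_nat_sqrt)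
      (intro subfield_Qbar_closed(4)[OF subfield_L] subfield_Qbar_of_int[OF subfield_L] s_in_L)
  have "of_int N * x - of_int m \<in> P"
    unfolding eq by (intro P_add P_of_int_mult P_mult[OF N1s(2,1)] 1 2 res(3))
  moreover have "ann (Suc n) (of_int N * x - of_int m)"
    unfolding eq by (intro ann_add ann_mult N1s algebraic_int_of_int ann_s ann_Suc 1 2)
  ultimately show ?case using \<open>\<not> int p dvd N\<close> by blast
qed

lemma integer_residue_mod_P:
  assumes "x \<in> L" "algebraic_int x" obtains m where "x - of_int m \<in> P"
proof -
  obtain n where "x \<in> K n" using assms by (auto simp: L_def)
  then obtain N m where N: "\<not> int p dvd N" "of_int N * x - of_int m \<in> P"
    using integer_residue assms(2) by blast
  have "coprime (int p) N" using prime_p N(1) by (intro prime_imp_coprime) auto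
  then obtain a b where "a * int p + b * N = 1" using bezout_int[of "int p" N] by auto
  then have "1 = of_int a * of_nat p + of_int b * (of_int N :: qbar)"
    by (metis of_int_1 of_int_add of_int_mult of_int_of_nat_eq)
  then have "1 * x = (of_int a * of_nat p + of_int b * of_int N) * x" by simp
  then have "x - of_int (b * m) = x * (of_int a * of_nat p) + of_int b * (of_int N * x - of_int m)"
    by (simp add: algebra_simps)
  also have "\<dots> \<in> P"
    using assms N(2) p_in_P by (intro P_add P_of_int_mult P_mult[of x])
  finally show ?thesis by (rule that)
qed

text \<open>For x in P the integer m congruent to N x lies in P too, so it is a multiple of p and
  \<open>ann\<close> holds for N x; as N is prime to p, it can be cancelled.\<close>

lemma ann_of_P:
  assumes "x \<in> P" "x \<in> K n" shows "ann n x"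
proof -
  obtain N m where N: "\<not> int p dvd N" "of_int N * x - of_int m \<in> P" "ann n (of_int N * x - of_int m)"
    using integer_residue assms P_subset by blast
  have "of_int N * x - (of_int N * x - of_int m) \<in> P"
    by (rule P_diff[OF P_of_int_mult[OF assms(1)] N(2)])
  then have "int p dvd m" by (simp add: of_int_in_P_iff)
  then obtain k where k: "m = k * int p" by (metis dvd_div_mult_self)
  have "ann n (of_int N * x - of_int m + of_int k * of_nat p)"
    using N(3) by (intro ann_add ann_mult ann_p algebraic_int_of_int)
  then have "ann n (of_int N * x)" by (simp add: k)
  moreover have "nat \<bar>N\<bar> = N \<or> nat \<bar>N\<bar> = - N" by auto
  then have "of_nat (nat \<bar>N\<bar>) = (of_int N :: qbar) \<or> of_nat (nat \<bar>N\<bar>) = (of_int (- N) :: qbar)"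
    by (metis of_int_of_nat_eq)
  ultimately have "ann n (of_nat (nat \<bar>N\<bar>) * x)"
    using ann_mult[of "- 1" n "of_int N * x"] by auto
  then have "algebraic_int (of_nat (nat \<bar>N\<bar>) * (x * split n / of_nat p))"
    by (simp add: ann_def mult.assoc)
  moreover have "algebraic_int (of_nat p * (x * split n / of_nat p))"
    using p_pos assms P_subset algebraic_int_split by (simp add: algebraic_int_mult)
  moreover have "coprime (nat \<bar>N\<bar>) p"
    using prime_p N(1) by (subst coprime_commute, intro prime_imp_coprime) (auto simp: int_dvd_int_iff[symmetric] simp del: int_dvd_int_iff)
  ultimately show ?thesis
    unfolding ann_def by (rule algebraic_int_coprime_mult[rotated 1])
qed

end

section \<open>Ramification and inertia\<close>

text \<open>The residue field coincides with the image of \<int>, so it has dimension 1 over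
  it.\<close>

lemma inertia_degree_at_eq_1:
  assumes L: "subfield L Qbar" and P: "maximalideal P (integers_of L)"
    and residue: "\<And>x. x \<in> L \<Longrightarrow> algebraic_int x \<Longrightarrow> \<exists>m. x - of_int m \<in> P"
  shows "inertia_degree_at L P = 1"
proof -
  interpret R: cring "integers_of L" by (rule cring_integers_of[OF L])
  define F where "F = integers_of L Quot P"
  define F0 where "F0 = range (\<lambda>m :: int. P +>\<^bsub>integers_of L\<^esub> of_int m)"
  have minus: "x \<ominus>\<^bsub>integers_of L\<^esub> y = x - y" if "x \<in> L" "algebraic_int x" "y \<in> L" "algebraic_int y" for x y
  proof -
    have "\<ominus>\<^bsub>integers_of L\<^esub> y = - y"
      using that subfield_Qbar_closed(5)[OF L] by (intro R.minus_equality) auto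
    then show ?thesis by (simp add: a_minus_def)
  qed
  have field_F: "field F" unfolding F_def
    by (rule maximalideal.quotient_is_field[OF P R.is_cring])
  then have ring_F: "ring F" by (intro cring.axioms(1) domain.axioms(1) field.axioms(1))
  note subfield_F = field.carrier_is_subfield[OF field_F]
  have "carrier F = F0"
  proof (intro equalityI subsetI)
    fix c assume "c \<in> carrier F"
    then obtain x where x: "x \<in> L" "algebraic_int x" "c = P +>\<^bsub>integers_of L\<^esub> x"
      by (auto simp: F_def FactRing_def A_RCOSETS_def')
    obtain m where m: "x - of_int m \<in> P" using residue[OF x(1,2)] by blast
    have "c = P +>\<^bsub>integers_of L\<^esub> of_int m"
      unfolding x(3) using x m R.quotient_eq_iff_same_a_r_cos[OF maximalideal.axioms(1)[OF P], of x "of_int m"]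
        minus[of x "of_int m"] subfield_Qbar_of_int[OF L] by simp
    then show "c \<in> F0" by (simp add: F0_def)
  next
    fix c assume "c \<in> F0"
    then show "c \<in> carrier F"
      using subfield_Qbar_of_int[OF L] by (auto simp: F0_def F_def FactRing_def A_RCOSETS_def')
  qed
  moreover note ring.dimension_one[OF ring_F subfield_F]
  ultimately have "ring.finite_dimension F F0 (carrier F)" "ring.dim F F0 (carrier F) = 1"
    using ring.finite_dimensionI[OF ring_F] ring.dimI[OF ring_F subfield_F] by (auto simp: over_def)
  then show ?thesis
    unfolding inertia_degree_at_def Let_def F_def[symmetric] F0_def[symmetric] by (simp add: one_enat_def)
qed

context split_prime
begin

text \<open>A strictly larger ideal contains some x outside P. Modulo P it is congruent to an
  integer m prime to p, and m and p together generate 1.\<close>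

lemma maximalideal_P: "maximalideal P OL"
proof (rule maximalidealI)
  show "ideal P OL" by (rule P.ideal_axioms)
  show "carrier OL \<noteq> P" by (rule P.I_notcarr)
  fix J assume J: "ideal J OL" "P \<subseteq> J" "J \<subseteq> carrier OL"
  have J_add: "x + y \<in> J" if "x \<in> J" "y \<in> J" for x y
    using additive_subgroup.a_closed[OF ideal.axioms(1)[OF J(1)], of x y] that by simp
  have J_of_int: "of_int k * x \<in> J" if "x \<in> J" for k x
    using ideal.I_l_closed[OF J(1) that, of "of_int k"] subfield_Qbar_of_int[OF subfield_L] by simp
  show "J = P \<or> J = carrier OL"
  proof (rule disjCI)
    assume "J \<noteq> carrier OL"
    show "J = P"
    proof (rule ccontr)
      assume "J \<noteq> P"
      then obtain x where x: "x \<in> J" "x \<notin> P" using J(2) by blast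
      then have "x \<in> L" "algebraic_int x" using J(3) by auto
      then obtain m where m: "x - of_int m \<in> P" by (rule integer_residue_mod_P)
      have "\<not> int p dvd m"
      proof
        assume "int p dvd m"
        then have "x - of_int m + of_int m \<in> P" using m by (intro P_add) (simp_all add: of_int_in_P_iff)
        then show False using x(2) by simp
      qed
      then have "coprime (int p) m" using prime_p by (intro prime_imp_coprime) auto
      then obtain a b where "a * int p + b * m = 1" using bezout_int[of "int p" m] by auto
      then have ab: "of_int a * of_nat p + of_int b * of_int m = (1 :: qbar)"
        by (metis of_int_1 of_int_add of_int_mult of_int_of_nat_eq)
      have "x + of_int (- 1) * (x - of_int m) \<in> J"
        using x(1) m J(2) by (intro J_add J_of_int) auto
      then have "of_int m \<in> J" by simp
      then have "of_int a * of_nat p + of_int b * of_int m \<in> J"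
        using p_in_P J(2) by (intro J_add J_of_int) auto
      then show False
        using ab ideal.one_imp_carrier[OF J(1)] \<open>J \<noteq> carrier OL\<close> by simp
    qed
  qed
qed

lemma inertia_degree_at_eq: "inertia_degree_at L P = 1"
  using subfield_L maximalideal_P
proof (rule inertia_degree_at_eq_1)
  fix x assume "x \<in> L" "algebraic_int x"
  then show "\<exists>m. x - of_int m \<in> P" using integer_residue_mod_P by metis
qed

text \<open>The square of \<open>P\<close> is annihilated by \<open>split n ^ 2\<close> modulo \<open>p\<^sup>2\<close>, whereas \<open>p\<close> is not.\<close>

definition ann2 :: "nat \<Rightarrow> qbar \<Rightarrow> bool" where
  "ann2 n y \<longleftrightarrow> algebraic_int (y * split n ^ 2 / of_nat p ^ 2)"

lemma ann2_mono: "m \<le> n \<Longrightarrow> ann2 m y \<Longrightarrow> ann2 n y"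
proof (induction rule: dec_induct)
  case (step n)
  then have "algebraic_int (y * split n ^ 2 / of_nat p ^ 2)" by (simp add: ann2_def)
  from algebraic_int_mult[OF this algebraic_int_power[OF algebraic_int_s_plus[of n], of 2]]
  show ?case by (simp add: ann2_def split_Suc power_mult_distrib mult_ac)
qed

lemma ann2_mult: "ann n x \<Longrightarrow> ann n y \<Longrightarrow> ann2 n (x * y)"
  using algebraic_int_mult[of "x * split n / of_nat p" "y * split n / of_nat p"]
  by (simp add: ann_def ann2_def power2_eq_square mult_ac)

lemma ann2_add: "ann2 n x \<Longrightarrow> ann2 n y \<Longrightarrow> ann2 n (x + y)"
  by (simp add: ann2_def distrib_right add_divide_distrib algebraic_int_add)

text \<open>Otherwise \<open>split n ^ 2\<close> would be p times an algebraic integer of L and so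
  lie in P, although \<open>split n\<close> does not.\<close>

lemma not_ann2_p: "\<not> ann2 n (of_nat p)"
proof
  assume "ann2 n (of_nat p)"
  then have "algebraic_int (split n ^ 2 / of_nat p)"
    using p_pos by (simp add: ann2_def power2_eq_square)
  moreover have "split n ^ 2 / of_nat p \<in> L"
    by (intro subfield_Qbar_closed(8)[OF subfield_L] subfield_Qbar_power[OF subfield_L] split_in_L
        subfield_Qbar_of_nat[OF subfield_L])
  ultimately have "split n ^ 2 / of_nat p * of_nat p \<in> P"
    using p_in_P by (intro P_mult)
  then have "split n * split n \<in> P" using p_pos by (simp add: power2_eq_square)
  then show False
    using P_prime[OF split_in_L algebraic_int_split split_in_L algebraic_int_split] split_notin_P by blast
qed

context
  fixes E assumes E: "number_field E" "E \<subseteq> L"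
begin

private abbreviation "idl e \<equiv> (P \<inter> E) [^]\<^bsub>ideals_set (integers_of E)\<^esub> (e :: nat)"

lemma idl_0: "idl 0 = carrier (integers_of E)" and idl_Suc: "idl (Suc e) = ideal_prod (integers_of E) (idl e) (P \<inter> E)"
  by (simp_all add: nat_pow_def ideals_set_def)

lemma idl_subset: "idl e \<subseteq> carrier OL" "idl (Suc e) \<subseteq> P"
proof -
  have step: "ideal_prod (integers_of E) A (P \<inter> E) \<subseteq> P" if "A \<subseteq> carrier OL" for A
  proof
    fix x assume "x \<in> ideal_prod (integers_of E) A (P \<inter> E)"
    then show "x \<in> P"
      by (induction rule: ideal_prod.induct) (use that P_mult P_add in auto)
  qed
  show 1: "idl e \<subseteq> carrier OL" for e
  proof (induction e)
    case 0
    show ?case unfolding idl_0 using E(2) by auto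
  next
    case (Suc e)
    then show ?case unfolding idl_Suc using step[OF Suc] P_subset by auto
  qed
  show "idl (Suc e) \<subseteq> P" unfolding idl_Suc by (rule step[OF 1])
qed

text \<open>Elements of a product of ideals are finite sums of products. Each product of two
  elements of P satisfies \<open>ann2\<close> at a level depending on these elements, and
  monotonicity provides a common level for a sum.\<close>

lemma p_notin_idl: "of_nat p \<notin> idl (Suc (Suc e))"
proof -
  have "\<exists>n. ann2 n y" if "y \<in> idl (Suc (Suc e))" for y
    using that unfolding idl_Suc[of "Suc e"]
  proof (induction rule: ideal_prod.induct)
    case (prod i j)
    then have ij: "i \<in> P" "j \<in> P" using idl_subset(2)[of e] by auto
    obtain n where n: "i \<in> K n" "j \<in> K n" using ij P_subset L_common by metis
    then show ?case using ann2_mult[OF ann_of_P[OF ij(1) n(1)] ann_of_P[OF ij(2) n(2)]] by auto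
  next
    case (sum y z)
    then obtain m n where "ann2 m y" "ann2 n z" by blast
    then have "ann2 (max m n) y" "ann2 (max m n) z"
      using ann2_mono[of m "max m n" y] ann2_mono[of n "max m n" z] by auto
    then have "ann2 (max m n) (y + z)" by (rule ann2_add)
    then show ?case by auto
  qed
  then show ?thesis using not_ann2_p by blast
qed

lemma ram_exponent_eq: "ram_exponent E (P \<inter> E) p = 1"
  unfolding ram_exponent_def
proof (rule Greatest_equality)
  have sub: "subfield E Qbar" using E(1) by (simp add: number_field_def)
  have "1 \<otimes>\<^bsub>integers_of E\<^esub> of_nat p \<in> ideal_prod (integers_of E) (idl 0) (P \<inter> E)"
    using p_in_P subfield_Qbar_of_nat[OF sub] subfield_Qbar_closed(1)[OF sub]
    unfolding idl_0 by (intro ideal_prod.prod) auto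
  then show "of_nat p \<in> idl 1"
    using idl_Suc[of 0] by simp
next
  fix e assume "of_nat p \<in> idl e"
  then have "e \<noteq> Suc (Suc k)" for k using p_notin_idl by blast
  then show "e \<le> 1" by (metis One_nat_def le_SucE le_refl not_less_eq_eq old.nat.exhaust zero_le)
qed

end

lemma ram_index_at_eq: "ram_index_at L P p = 1"
proof -
  \<comment> \<open>The supremum of the constant 1 is 1 only over a nonempty family.\<close>
  have "\<rat> \<in> {E. number_field E \<and> E \<subseteq> L}"
    using number_field_K[of 0] K_subset_L[of 0] by simp
  then show ?thesis
    unfolding ram_index_at_def by (intro SUP_eq_const) (auto simp: ram_exponent_eq one_enat_def)
qed

end

context multiquad_tower
begin

lemma S_local_split_prime:
  assumes "prime p" "odd p" "\<And>i. \<not> p dvd d i \<and> (\<exists>r. int p dvd r ^ 2 - int (d i))"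
  shows "S_local L p = ln (real p) / (real p + 1)"
proof -
  have "p > 1" using assms(1) by (rule prime_gt_1_nat)
  then have "(SOME P. P \<in> primes_above L p) \<in> primes_above L p"
    using primes_above_nonempty[OF subfield_L, of p] some_in_eq by blast
  then interpret split_prime d p "SOME P. P \<in> primes_above L p"
    using assms by unfold_locales auto
  show ?thesis
    unfolding S_local_def ram_index_def inertia_degree_def ram_index_at_eq inertia_degree_at_eq
    by (simp add: one_enat_def)
qed

end

section \<open>The choice of the radicands\<close>

lemma squarefree_eq_prod_prime_factors:
  fixes n :: nat
  assumes "squarefree n" shows "\<Prod>(prime_factors n) = n"
proof -
  have n: "n \<noteq> 0" using assms by (metis not_squarefree_0)
  have "multiplicity p n = 1" if "p \<in> prime_factors n" for p
    using that assms n by (auto simp: squarefree_factorial_semiring'' prime_factors_multiplicity intro: le_antisym)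
  then have "(\<Prod>p\<in>prime_factors n. p ^ multiplicity p n) = \<Prod>(prime_factors n)"
    by (intro prod.cong) auto
  then show ?thesis using prod_prime_factors[OF n] by simp
qed

text \<open>Writing \<open>n = m\<^sup>2 r\<close> with \<open>r\<close> squarefree bounds the harmonic numbers by
  \<open>(\<Sum> 1 / m\<^sup>2) (\<Prod> (1 + 1 / p))\<close>.\<close>

lemma not_summable_on_inverse_primes: "\<not> (\<lambda>p. 1 / real p) summable_on {p. prime p}"
proof
  define f :: "nat \<Rightarrow> real" where "f = (\<lambda>p. 1 / real p)"
  assume "(\<lambda>p. 1 / real p) summable_on {p. prime p}"
  then have f: "f summable_on {p. prime p}" by (simp add: f_def)
  define S where "S = infsum f {p. prime p}"
  \<comment> \<open>The term for m = 0 is inverse 0 = 0, so the sum may start there.\<close>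
  define C where "C = (\<Sum>m. inverse (real m ^ 2))"
  have "harm N \<le> C * exp S" for N
  proof -
    define Q where "Q = {p. prime p \<and> p \<le> N}"
    \<comment> \<open>A number n = m^2 r is encoded by m and the set of primes of r. Each set of
      primes in the second component stands for one term in the expansion of the product of the 1 +
      1/p.\<close>
    define \<phi> where "\<phi> = (\<lambda>n::nat. (square_part n, prime_factors (squarefree_part n)))"
    define g where "g = (\<lambda>(m::nat, A). inverse (real m ^ 2) * (\<Prod>p\<in>A. f p))"
    have Q: "finite Q" unfolding Q_def by (rule finite_subset[of _ "{..N}"]) auto
    have recover: "n = \<Prod>(snd (\<phi> n)) * fst (\<phi> n) ^ 2" for n
      using squarefree_decompose[of n] by (simp add: \<phi>_def squarefree_eq_prod_prime_factors squarefree_squarefree_part)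
    have inj: "inj_on \<phi> {1..N}"
      by (rule inj_onI) (metis recover)
    have range: "\<phi> ` {1..N} \<subseteq> {..N} \<times> Pow Q"
    proof
      fix x assume "x \<in> \<phi> ` {1..N}"
      then obtain n where n: "x = \<phi> n" "n \<ge> 1" "n \<le> N" by auto
      have dvd: "square_part n dvd n" "squarefree_part n dvd n"
        using squarefree_decompose[of n] by (metis dvd_triv_left dvd_triv_right dvd_trans power2_eq_square, metis dvd_triv_left)
      then have "square_part n \<le> N" using n dvd_imp_le[OF dvd(1)] by simp
      moreover have "p \<le> N" if "p \<in> prime_factors (squarefree_part n)" for p
      proof -
        have "p dvd n" using that dvd(2) by (meson dvd_trans in_prime_factors_imp_dvd)
        then show ?thesis using n dvd_imp_le[of p n] by simp
      qed
      ultimately show "x \<in> {..N} \<times> Pow Q" unfolding n(1) \<phi>_def Q_def by auto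
    qed
    have g: "g (\<phi> n) = inverse (real n)" for n
    proof -
      have "real n = (\<Prod>p\<in>snd (\<phi> n). real p) * real (fst (\<phi> n)) ^ 2"
        by (subst recover[of n]) simp
      then show ?thesis
        by (simp add: g_def case_prod_unfold f_def prod_dividef field_simps)
    qed
    have f_nonneg: "f p \<ge> 0" for p by (simp add: f_def)
    have "harm N = (\<Sum>n\<in>{1..N}. g (\<phi> n))" by (simp add: harm_def g)
    also have "\<dots> = sum g (\<phi> ` {1..N})" using inj by (simp add: sum.reindex)
    also have "\<dots> \<le> sum g ({..N} \<times> Pow Q)"
      using Q f_nonneg by (intro sum_mono2 range) (auto simp: g_def intro!: mult_nonneg_nonneg prod_nonneg)
    also have "\<dots> = (\<Sum>m\<le>N. inverse (real m ^ 2)) * (\<Sum>A\<in>Pow Q. \<Prod>p\<in>A. f p)"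
      unfolding g_def sum_product sum.cartesian_product by simp
    also have "(\<Sum>A\<in>Pow Q. \<Prod>p\<in>A. f p) = (\<Prod>p\<in>Q. f p + 1)"
      using prod_add[OF Q, of f "\<lambda>_. 1"] by simp
    also have "\<dots> \<le> (\<Prod>p\<in>Q. exp (f p))"
      using f_nonneg by (intro prod_mono) (auto simp: add.commute intro: exp_ge_add_one_self add_nonneg_nonneg)
    also have "\<dots> = exp (sum f Q)" using Q by (simp add: exp_sum)
    also have "sum f Q \<le> S"
      unfolding S_def using f Q f_nonneg by (intro finite_sum_le_infsum) (auto simp: Q_def)
    also have "(\<Sum>m\<le>N. inverse (real m ^ 2)) \<le> C"
      unfolding C_def by (intro sum_le_suminf inverse_power_summable) auto
    finally show ?thesis by (simp add: mult_left_mono mult_right_mono sum_nonneg)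
  qed
  moreover have "eventually (\<lambda>N. harm N > C * exp S) sequentially"
    using harm_at_top unfolding filterlim_at_top_dense by blast
  ultimately show False
    using eventually_happens'[OF sequentially_bot] by (metis not_le)
qed

text \<open>The value of S_p when ramification index and inertia degree are both 1.\<close>

definition prime_weight :: "nat \<Rightarrow> real" where
  "prime_weight p = ln (real p) / (real p + 1)"

lemma prime_weight_nonneg: "prime p \<Longrightarrow> prime_weight p \<ge> 0"
  using prime_gt_0_nat[of p] by (auto simp: prime_weight_def intro!: divide_nonneg_pos ln_ge_zero)

definition splitting_primes :: "nat set \<Rightarrow> nat set" where
  "splitting_primes D =
     {p. prime p \<and> odd p \<and> (\<forall>e\<in>D. \<not> p dvd e \<and> (\<exists>r. int p dvd r ^ 2 - int e))}"

text \<open>For p \<ge> 3 one has p + 1 \<le> 2 p and, as exp 1 \<le> 3, also ln p \<ge> 1; so 1/p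
  is at most twice the weight. Without radicands the set consists of all odd primes, and 2 is added
  back.\<close>

lemma not_summable_on_splitting_primes_empty: "\<not> prime_weight summable_on splitting_primes {}"
proof
  assume "prime_weight summable_on splitting_primes {}"
  then have "(\<lambda>p. 2 * prime_weight p) summable_on splitting_primes {}"
    by (rule summable_on_cmult_right)
  then have "(\<lambda>p. 1 / real p) summable_on splitting_primes {}"
  proof (rule summable_on_comparison_test)
    fix p assume "p \<in> splitting_primes {}"
    then have "prime p" "odd p" by (auto simp: splitting_primes_def)
    then have "p \<ge> 3" using prime_ge_2_nat[of p] by (cases "p = 2") auto
    then have "exp 1 \<le> real p" using exp_le by linarith
    then have "ln (real p) \<ge> 1" using \<open>p \<ge> 3\<close> by (simp add: ln_ge_iff)
    then have "(real p + 1) * 1 \<le> 2 * real p * ln (real p)"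
      using \<open>p \<ge> 3\<close> by (intro mult_mono) auto
    then show "1 / real p \<le> 2 * prime_weight p"
      using \<open>p \<ge> 3\<close> by (simp add: prime_weight_def field_simps)
  qed simp
  then have "(\<lambda>p. 1 / real p) summable_on (splitting_primes {} \<union> {2})"
    by (rule summable_on_Un_disjoint) (auto simp: splitting_primes_def)
  moreover have "splitting_primes {} \<union> {2} = {p. prime p}"
    using primes_dvd_imp_eq[OF two_is_prime_nat] by (auto simp: splitting_primes_def)
  ultimately show False using not_summable_on_inverse_primes by simp
qed

text \<open>The modulus m collects in one number all primes that e must avoid and modulo which it
  must be a square.\<close>

definition sqrt_candidate :: "nat \<Rightarrow> nat \<Rightarrow> bool" where
  "sqrt_candidate m e \<longleftrightarrow> squarefree e \<and> e > 1 \<and> coprime e m \<and>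
     (\<forall>p. prime p \<longrightarrow> p dvd m \<longrightarrow> (\<exists>r. int p dvd r ^ 2 - int e))"

text \<open>The squarefree part of \<open>m\<^sup>2 + 1\<close> is a square modulo every prime divisor of \<open>m\<close>.\<close>

lemma ex_sqrt_candidate:
  assumes "m > 0" shows "\<exists>e. sqrt_candidate m e"
proof
  define e where "e = squarefree_part (m ^ 2 + 1)"
  define k where "k = square_part (m ^ 2 + 1)"
  have ek: "m ^ 2 + 1 = e * k ^ 2" unfolding e_def k_def by (rule squarefree_decompose)
  \<comment> \<open>m^2 + 1 lies strictly between m^2 and (m + 1)^2, so it is not a square.\<close>
  have "e \<noteq> 1"
  proof
    assume "e = 1"
    then have "k ^ 2 = m ^ 2 + 1" using ek by simp
    then have "m ^ 2 < k ^ 2" "k ^ 2 < (m + 1) ^ 2" using assms by (auto simp: power2_eq_square)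
    then show False by (auto dest!: power_less_imp_less_base)
  qed
  moreover have "e \<noteq> 0" unfolding e_def by simp
  ultimately have "e > 1" by linarith
  moreover have "squarefree e" unfolding e_def by (rule squarefree_squarefree_part)
  moreover have "coprime e m"
  proof (rule coprimeI)
    fix c assume c: "c dvd e" "c dvd m"
    then have "c dvd m ^ 2 + 1" "c dvd m ^ 2" unfolding ek by (simp_all add: power2_eq_square)
    then show "is_unit c" using dvd_diff_nat[of c "m ^ 2 + 1" "m ^ 2"] by simp
  qed
  moreover have "\<exists>r. int p dvd r ^ 2 - int e" if p: "prime p" "p dvd m" for p
  proof -
    have "\<not> p dvd k"
    proof
      assume "p dvd k"
      then have "p dvd m ^ 2 + 1" "p dvd m ^ 2" unfolding ek using p(2) by (simp_all add: power2_eq_square)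
      then have "p dvd 1" using dvd_diff_nat[of p "m ^ 2 + 1" "m ^ 2"] by simp
      then show False using p(1) by simp
    qed
    then have "coprime (int p) (int k)" using p(1) by (simp add: prime_imp_coprime)
    then obtain a b where ab: "a * int p + b * int k = 1" using bezout_int[of "int p" "int k"] by auto
    have "int m ^ 2 + 1 = int e * int k ^ 2" using ek by (metis of_nat_1 of_nat_add of_nat_mult of_nat_power)
    moreover obtain l where "int m = int p * l" using p(2) by (metis dvdE int_dvd_int_iff)
    ultimately have "int e * int k ^ 2 = 1 + int p * (l * int p * l)"
      by (simp add: power2_eq_square algebra_simps)
    \<comment> \<open>b inverts k modulo p, and e k^2 = m^2 + 1 is 1 modulo p; hence e is congruent
      to b^2, and b is the required root.\<close>
    have bk: "b * int k = 1 - a * int p" using ab by simp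
    have "int e * (b * int k) ^ 2 = b ^ 2 * (int e * int k ^ 2)" by (simp add: power_mult_distrib)
    also have "\<dots> = b ^ 2 * (1 + int p * (l * int p * l))" using \<open>int e * int k ^ 2 = _\<close> by simp
    finally have "b ^ 2 - int e = int p * (- (b ^ 2 * (l * int p * l)) + int e * (a * int p * a - 2 * a))"
      unfolding bk by (simp add: power2_eq_square algebra_simps)
    then show ?thesis by (metis dvd_triv_left)
  qed
  ultimately show "sqrt_candidate m e"
    unfolding sqrt_candidate_def by blast
qed

lemma sqrt_candidate_dvd: "sqrt_candidate m e \<Longrightarrow> m' dvd m \<Longrightarrow> sqrt_candidate m' e"
  unfolding sqrt_candidate_def by (meson coprime_divisors dvd_refl dvd_trans)

lemma sqrt_candidate_mult:
  assumes "sqrt_candidate m e" "sqrt_candidate m e'" "coprime e e'"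
  shows "sqrt_candidate m (e * e')"
  unfolding sqrt_candidate_def
proof (intro conjI allI impI)
  show "squarefree (e * e')"
    using assms by (intro squarefree_mult_coprime) (auto simp: sqrt_candidate_def)
  show "1 < e * e'" using assms less_1_mult[of e e'] by (simp add: sqrt_candidate_def)
  show "coprime (e * e') m" using assms by (auto simp: sqrt_candidate_def)
  fix p assume p: "prime p" "p dvd m"
  obtain r r' where "int p dvd r ^ 2 - int e" "int p dvd r' ^ 2 - int e'"
    using assms p unfolding sqrt_candidate_def by blast
  then have "int p dvd r ^ 2 * (r' ^ 2 - int e') + (r ^ 2 - int e) * int e'" by simp
  also have "\<dots> = (r * r') ^ 2 - int (e * e')" by (simp add: algebra_simps power_mult_distrib)
  finally show "\<exists>r. int p dvd r ^ 2 - int (e * e')" by blast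
qed

lemma QuadRes_iff_dvd: "QuadRes p a \<longleftrightarrow> (\<exists>r. p dvd r ^ 2 - a)"
  by (simp add: QuadRes_def cong_iff_dvd_diff)

text \<open>By Euler's criterion the Legendre symbol is multiplicative modulo p. Three symbols equal
  to -1 would give 1 = -1 modulo p, impossible for p > 2.\<close>

lemma product_of_nonresidues:
  assumes p: "prime p" "odd p" and "\<not> p dvd e" "\<not> p dvd e'"
  shows "(\<exists>r. int p dvd r ^ 2 - int e) \<or> (\<exists>r. int p dvd r ^ 2 - int e') \<or>
    (\<exists>r. int p dvd r ^ 2 - int (e * e'))"
proof -
  have p2: "p > 2" using p prime_ge_2_nat[of p] by (cases "p = 2") auto
  define L where "L = (\<lambda>a. Legendre (int a) (int p))"
  have L: "L a = (if QuadRes (int p) (int a) then 1 else - 1)" if "\<not> p dvd a" for a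
    using that by (simp add: L_def Legendre_def cong_0_iff)
  have euler: "[L a = int a ^ ((p - 1) div 2)] (mod int p)" for a
    unfolding L_def by (rule euler_criterion[OF p(1) p2])
  have nd: "\<not> p dvd e * e'" using assms by (simp add: prime_dvd_mult_iff)
  have "[L e * L e' = int e ^ ((p - 1) div 2) * int e' ^ ((p - 1) div 2)] (mod int p)"
    by (intro cong_mult euler)
  also have "int e ^ ((p - 1) div 2) * int e' ^ ((p - 1) div 2) = int (e * e') ^ ((p - 1) div 2)"
    by (simp add: power_mult_distrib)
  also have "[\<dots> = L (e * e')] (mod int p)" by (rule cong_sym[OF euler])
  finally have cong: "[L e * L e' = L (e * e')] (mod int p)" .
  have "\<not> [1 = - 1] (mod int p)"
  proof
    assume "[1 = - 1] (mod int p)"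
    then have "int p dvd 2" by (simp add: cong_iff_dvd_diff)
    then have "int p \<le> 2" by (rule zdvd_imp_le) simp
    then show False using p2 by simp
  qed
  then have "QuadRes (int p) (int e) \<or> QuadRes (int p) (int e') \<or> QuadRes (int p) (int (e * e'))"
    using cong L[OF assms(3)] L[OF assms(4)] L[OF nd] by (auto split: if_splits)
  then show ?thesis unfolding QuadRes_iff_dvd .
qed

lemma summable_on_Un:
  fixes f :: "'a \<Rightarrow> real"
  assumes "f summable_on A" "f summable_on B" shows "f summable_on (A \<union> B)"
proof -
  have "f summable_on (A \<union> (B - A))"
    using assms by (intro summable_on_Un_disjoint summable_on_subset_banach[of f B "B - A"]) auto
  then show ?thesis by simp
qed

lemma extend_splitting_set:
  assumes D: "finite D" "\<And>e. e \<in> D \<Longrightarrow> e > 0"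
    and div: "\<not> prime_weight summable_on splitting_primes D"
  shows "\<exists>e. squarefree e \<and> e > B \<and> e > 1 \<and> odd e \<and> (\<forall>e'\<in>D. coprime e e') \<and>
    (\<forall>p. prime p \<longrightarrow> p \<le> B \<longrightarrow> \<not> p dvd e \<and> (\<exists>r. int p dvd r ^ 2 - int e)) \<and>
    \<not> prime_weight summable_on splitting_primes (insert e D)"
proof -
  \<comment> \<open>The factor 2 makes the radicand odd, the factorial covers the primes up to B,
    and the product over D gives coprimality to the earlier radicands.\<close>
  define m where "m = 2 * fact B * \<Prod>D"
  have "m > 0" using D by (simp add: m_def prod_pos)
  then obtain e where e: "sqrt_candidate m e" using ex_sqrt_candidate by blast
  then have "m * e > 0" using \<open>m > 0\<close> by (simp add: sqrt_candidate_def)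
  \<comment> \<open>Taking m e as modulus makes e' coprime to e, so that e e' is squarefree and
    again a candidate for m.\<close>
  then obtain e' where "sqrt_candidate (m * e) e'" using ex_sqrt_candidate by blast
  then have e': "sqrt_candidate m e'" "coprime e e'"
    using sqrt_candidate_dvd[of "m * e" e' m] by (auto simp: sqrt_candidate_def coprime_commute)
  have ee': "sqrt_candidate m (e * e')" using sqrt_candidate_mult e e' by blast
  have "e > 0" "e' > 0" using e e' by (auto simp: sqrt_candidate_def)
  have "splitting_primes D \<subseteq> splitting_primes (insert e D) \<union> splitting_primes (insert e' D)
      \<union> splitting_primes (insert (e * e') D) \<union> {p. p dvd e * e'}"
  proof
    fix p assume p: "p \<in> splitting_primes D"
    show "p \<in> splitting_primes (insert e D) \<union> splitting_primes (insert e' D)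
      \<union> splitting_primes (insert (e * e') D) \<union> {p. p dvd e * e'}"
    proof (cases "p dvd e * e'")
      case False
      then have nd: "\<not> p dvd e" "\<not> p dvd e'" by auto
      have "prime p" "odd p" using p by (auto simp: splitting_primes_def)
      from product_of_nonresidues[OF this nd] show ?thesis
        using p False nd unfolding splitting_primes_def by auto
    qed simp
  qed
  then have "\<not> prime_weight summable_on (splitting_primes (insert e D) \<union> splitting_primes (insert e' D)
      \<union> splitting_primes (insert (e * e') D) \<union> {p. p dvd e * e'})"
    using div summable_on_subset_banach by blast
  moreover have "prime_weight summable_on {p. p dvd e * e'}"
    using \<open>e > 0\<close> \<open>e' > 0\<close> by (intro summable_on_finite) simp
  ultimately have "\<exists>x\<in>{e, e', e * e'}. \<not> prime_weight summable_on splitting_primes (insert x D)"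
    using summable_on_Un[of prime_weight] by (metis insertCI)
  then obtain x where x: "sqrt_candidate m x" "\<not> prime_weight summable_on splitting_primes (insert x D)"
    using e e'(1) ee' by auto
  have coprime_x: "coprime x y" if "y dvd m" for y
    using x(1) that by (meson coprime_divisors dvd_refl sqrt_candidate_def)
  have small: "p dvd m" if "prime p" "p \<le> B" for p
    using that prime_gt_0_nat[of p] dvd_fact[of p B] by (auto simp: m_def)
  have nd: "\<not> p dvd x" if "prime p" "p \<le> B" for p
    using coprime_x[OF small[OF that]] that(1) by (metis coprime_absorb_right not_prime_unit)
  \<comment> \<open>Primes up to B divide m and hence not x, so every prime factor of x exceeds
    B.\<close>
  have "x > B"
  proof (rule ccontr)
    assume "\<not> x > B"
    obtain p where p: "prime p" "p dvd x"
      using x(1) prime_factor_nat[of x] by (auto simp: sqrt_candidate_def)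
    then have "p \<le> x" using x(1) by (intro dvd_imp_le) (auto simp: sqrt_candidate_def)
    then show False using nd[OF p(1)] p(2) \<open>\<not> x > B\<close> by simp
  qed
  moreover have "coprime x 2" by (rule coprime_x) (simp add: m_def)
  then have "odd x" by simp
  moreover have "coprime x y" if "y \<in> D" for y
    using that D(1) by (intro coprime_x) (auto simp: m_def intro: dvd_mult dvd_prodI)
  moreover have "squarefree x" "x > 1" using x(1) by (auto simp: sqrt_candidate_def)
  moreover have "\<exists>r. int p dvd r ^ 2 - int x" if "prime p" "p \<le> B" for p
    using x(1) small[OF that] that(1) by (simp add: sqrt_candidate_def)
  ultimately show ?thesis
    using x(2) nd by (intro exI[of _ x]) simp
qed

lemma not_summable_on_large_sum:
  fixes f :: "'a \<Rightarrow> real"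
  assumes "\<not> f summable_on A" "\<And>x. x \<in> A \<Longrightarrow> f x \<ge> 0"
  shows "\<exists>F. finite F \<and> F \<subseteq> A \<and> C \<le> sum f F"
proof (rule ccontr)
  assume "\<not> ?thesis"
  then have "sum f F \<le> C" if "finite F" "F \<subseteq> A" for F
    using that by (meson nle_le)
  then have "eventually (\<lambda>F. sum f F \<le> C) (finite_subsets_at_top A)"
    by (rule eventually_finite_subsets_at_top_weakI)
  then have "f summable_on A"
    using assms(2) by (intro nonneg_bounded_partial_sums_imp_summable_on[where C = C])
  then show False using assms(1) by simp
qed

text \<open>The stages of the construction: the set \<open>D\<close> of radicands chosen so far, the bound \<open>B\<close> below
  which splitting is not to be disturbed any more, and the next radicand \<open>e\<close>.\<close>

definition stage :: "nat \<Rightarrow> nat set \<times> nat \<times> nat \<Rightarrow> bool" where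
  "stage n = (\<lambda>(D, B, e). finite D \<and> (\<forall>e'\<in>D. e' > 0) \<and>
     (\<exists>F. F \<subseteq> splitting_primes D \<inter> {..B} \<and> real n \<le> sum prime_weight F) \<and>
     squarefree e \<and> e > n \<and> e > 1 \<and> odd e \<and> (\<forall>e'\<in>D. coprime e e') \<and>
     (\<forall>p. prime p \<longrightarrow> p \<le> B \<longrightarrow> \<not> p dvd e \<and> (\<exists>r. int p dvd r ^ 2 - int e)) \<and>
     \<not> prime_weight summable_on splitting_primes (insert e D))"

lemma ex_stage:
  assumes D: "finite D" "\<And>e. e \<in> D \<Longrightarrow> e > 0"
    and div: "\<not> prime_weight summable_on splitting_primes D"
  shows "\<exists>B e. B' \<le> B \<and> stage n (D, B, e)"
proof -
  have "prime_weight p \<ge> 0" if "p \<in> splitting_primes D" for p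
    using that by (simp add: splitting_primes_def prime_weight_nonneg)
  then obtain F where F: "finite F" "F \<subseteq> splitting_primes D" "real n \<le> sum prime_weight F"
    using not_summable_on_large_sum[OF div, of "real n"] by blast
  \<comment> \<open>One bound meets three demands: it is at least n, so that e > B gives e > n; at
    least B', so that the bounds never decrease; and at least every element of F, so that F stays
    protected.\<close>
  define B where "B = n + B' + \<Sum>F"
  have B: "n \<le> B" "B' \<le> B" "F \<subseteq> {..B}"
    unfolding B_def using F(1) member_le_sum[of _ F "\<lambda>x. x"] by (auto intro: trans_le_add2)
  obtain e where "squarefree e \<and> e > B \<and> e > 1 \<and> odd e \<and> (\<forall>e'\<in>D. coprime e e') \<and>
    (\<forall>p. prime p \<longrightarrow> p \<le> B \<longrightarrow> \<not> p dvd e \<and> (\<exists>r. int p dvd r ^ 2 - int e)) \<and>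
    \<not> prime_weight summable_on splitting_primes (insert e D)"
    using extend_splitting_set[OF assms] by blast
  moreover have "F \<subseteq> splitting_primes D \<inter> {..B}" using F B by simp
  ultimately have "stage n (D, B, e)"
    using D F(3) B(1) by (auto simp: stage_def simp del: le_inf_iff Int_subset_iff)
  then show ?thesis using B(2) by blast
qed

text \<open>A prime p of the nth finite set is at most \<open>B n\<close> and splits for the
  radicands in \<open>D n\<close>, which settles d i for i < n. For i \<ge> n, d i is a nonzero
  square modulo all primes up to \<open>B i\<close>, and these include p because B is
  monotone.\<close>

lemma ex_radicands:
  "\<exists>d. (\<forall>n. squarefree (d n) \<and> d n > 1 \<and> d n > n \<and> odd (d n)) \<and>
     (\<forall>m n. m \<noteq> n \<longrightarrow> coprime (d m) (d n)) \<and>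
     (\<forall>n. \<exists>F. finite F \<and> F \<subseteq> splitting_primes (range d) \<and> real n \<le> sum prime_weight F)"
proof -
  define Q :: "nat \<Rightarrow> nat set \<times> nat \<times> nat \<Rightarrow> nat set \<times> nat \<times> nat \<Rightarrow> bool" where
    "Q = (\<lambda>_ (D, B, e) (D', B', e'). D' = insert e D \<and> B \<le> B')"
  have "\<exists>f. \<forall>n. stage n (f n) \<and> Q n (f n) (f (Suc n))"
  proof (rule dependent_nat_choice)
    show "\<exists>x. stage 0 x"
      using ex_stage[of "{}" 0 0] not_summable_on_splitting_primes_empty by auto
    fix x n assume "stage n x"
    obtain D B e where x: "x = (D, B, e)" by (cases x)
    have "\<exists>B' e'. B \<le> B' \<and> stage (Suc n) (insert e D, B', e')"
      using \<open>stage n x\<close> unfolding x by (intro ex_stage) (auto simp: stage_def)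
    then show "\<exists>y. stage (Suc n) y \<and> Q n x y" unfolding x Q_def by auto
  qed
  then obtain f where f: "\<And>n. stage n (f n)" "\<And>n. Q n (f n) (f (Suc n))" by blast
  define D B d where "D n = fst (f n)" and "B n = fst (snd (f n))" and "d n = snd (snd (f n))" for n
  have st: "stage n (D n, B n, d n)" for n using f(1)[of n] by (simp add: D_def B_def d_def)
  have D_Suc: "D (Suc n) = insert (d n) (D n)" and B_Suc: "B n \<le> B (Suc n)" for n
    using f(2)[of n] by (auto simp: Q_def D_def B_def d_def case_prod_unfold)
  have B_mono: "B i \<le> B j" if "i \<le> j" for i j using that B_Suc by (rule lift_Suc_mono_le[rotated])
  have in_D: "d i \<in> D j" if "i < j" for i j
    using that by (induction j) (auto simp: D_Suc less_Suc_eq)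
  have "\<exists>F. finite F \<and> F \<subseteq> splitting_primes (range d) \<and> real n \<le> sum prime_weight F" for n
  proof -
    obtain F where F: "F \<subseteq> splitting_primes (D n) \<inter> {..B n}" "real n \<le> sum prime_weight F"
      using st[of n] by (auto simp: stage_def)
    have "p \<in> splitting_primes (range d)" if p: "p \<in> splitting_primes (D n)" "p \<le> B n" for p
    proof -
      have "\<not> p dvd d i \<and> (\<exists>r. int p dvd r ^ 2 - int (d i))" for i
      proof (cases "i < n")
        case True
        then show ?thesis using p(1) in_D by (auto simp: splitting_primes_def)
      next
        case False
        then have "p \<le> B i" using p(2) B_mono[of n i] by simp
        then show ?thesis using p(1) st[of i] by (auto simp: stage_def splitting_primes_def)
      qed
      then show ?thesis using p(1) by (auto simp: splitting_primes_def)
    qed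
    then show ?thesis using F finite_subset[of F "{..B n}"] by blast
  qed
  moreover have "coprime (d m) (d n)" if "m \<noteq> n" for m n
  proof (cases "m < n")
    case True
    then show ?thesis using st[of n] in_D by (auto simp: stage_def coprime_commute)
  next
    case False
    then show ?thesis using st[of m] in_D[of n m] that by (auto simp: stage_def)
  qed
  ultimately show ?thesis
    using st by (intro exI[of _ d]) (auto simp: stage_def)
qed

section \<open>The discriminant limit and the divergence of S(L)\<close>

context multiquad_tower
begin

lemma intermediate_fields:
  "{M. subfield M Qbar \<and> K n \<subset> M \<and> M \<subseteq> K (Suc n)} = {K (Suc n)}"
proof (intro equalityI subsetI)
  fix M assume "M \<in> {M. subfield M Qbar \<and> K n \<subset> M \<and> M \<subseteq> K (Suc n)}"
  then show "M \<in> {K (Suc n)}"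
    using quad_ext_no_intermediate[OF quad_facts, of M n] by simp
qed (use subfield_multiquad[of d "Suc n"] K_strict_mono[of n] in auto)

lemma discriminant_term_ge:
  "real (d n) powr (1 / 4) \<le>
    (INF M\<in>{M. subfield M Qbar \<and> K n \<subset> M \<and> M \<subseteq> K (Suc n)}.
      real (ideal_norm (K n) (rel_discriminant (K n) M)) powr
        (1 / (real (ext_degree (K 0) M) * real (ext_degree (K n) M))))"
proof -
  define D where "D = ideal_norm (K n) (rel_discriminant (K n) (K (Suc n)))"
  \<comment> \<open>The degrees of \<open>K (Suc n)\<close> are 2^(n+1) over \<rat> and 2 over
    \<open>K n\<close>; together with the exponent 2^n of the norm bound this gives 1/4.\<close>
  have "real (d n) powr (1 / 4) = (real (d n) powr real (2 ^ n)) powr (1 / (2 ^ Suc n * 2))"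
    by (simp add: powr_powr)
  also have "real (d n) powr real (2 ^ n) = real (d n ^ 2 ^ n)"
    using d_gt_1[of n] by (subst powr_realpow) auto
  also have "real (d n ^ 2 ^ n) powr (1 / (2 ^ Suc n * 2)) \<le> real D powr (1 / (2 ^ Suc n * 2))"
    using ideal_norm_ge[of n] by (intro powr_mono2) (simp_all only: D_def of_nat_le_iff, simp_all)
  finally have "real (d n) powr (1 / 4) \<le> real D powr (1 / (2 ^ Suc n * 2))" .
  then show ?thesis
    unfolding intermediate_fields multiquad.simps(1) ext_degree_K D_def
    using ext_degree_K(1)[of "Suc n"] ext_degree_K(2)[of n] by simp
qed

text \<open>All terms are nonnegative, so the total is at least each finite partial sum, and by
  hypothesis these exceed every bound.\<close>

lemma S_total_L:
  assumes "\<And>n. \<exists>F. finite F \<and> F \<subseteq> splitting_primes (range d) \<and> real n \<le> sum prime_weight F"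
  shows "S_total L = \<infinity>"
proof (rule ccontr)
  assume "S_total L \<noteq> \<infinity>"
  then obtain n where n: "S_total L < of_nat n"
    using ennreal_Ex_less_of_nat by (auto simp: less_top infinity_ennreal_def)
  obtain F where F: "finite F" "F \<subseteq> splitting_primes (range d)" "real n \<le> sum prime_weight F"
    using assms by blast
  have primes: "F \<subseteq> {p. prime p}" using F(2) by (auto simp: splitting_primes_def)
  have "of_nat n = ennreal (real n)" by (simp add: ennreal_of_nat_eq_real_of_nat)
  also have "\<dots> \<le> ennreal (sum prime_weight F)" using F(3) by (rule ennreal_leI)
  also have "\<dots> = (\<Sum>p\<in>F. ennreal (prime_weight p))"
    using primes prime_weight_nonneg by (intro sum_ennreal[symmetric]) auto
  also have "\<dots> = (\<Sum>p\<in>F. ennreal (S_local L p))"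
  proof (rule sum.cong[OF refl])
    fix p assume "p \<in> F"
    then have "p \<in> splitting_primes (range d)" using F(2) by blast
    then show "ennreal (prime_weight p) = ennreal (S_local L p)"
      using S_local_split_prime[of p] by (simp add: splitting_primes_def prime_weight_def)
  qed
  also have "\<dots> \<le> S_total L"
    unfolding S_total_def nonneg_infsum_complete[of _ "\<lambda>p. ennreal (S_local L p)", OF zero_le]
    using F(1) primes by (intro SUP_upper) auto
  finally show False using n by simp
qed

end

theorem proposition8p3:
  shows "\<exists>L :: qbar set. galois_ext L \<and> \<not> finite_ext \<rat> L \<and> L \<subseteq> Q2ab \<and> property_S L \<and>
    (\<exists>K :: nat \<Rightarrow> qbar set.
       (\<forall>i. number_field (K i)) \<and> (\<forall>i. K i \<subset> K (Suc i)) \<and> L = (\<Union>i. K i) \<and>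
       filterlim
         (\<lambda>i. INF M\<in>{M. subfield M Qbar \<and> K i \<subset> M \<and> M \<subseteq> K (Suc i)}.
            real (ideal_norm (K i) (rel_discriminant (K i) M)) powr
              (1 / (real (ext_degree (K 0) M) * real (ext_degree (K i) M))))
         at_top sequentially)"
proof -
  obtain d where d: "\<And>n. squarefree (d n) \<and> d n > 1 \<and> d n > n \<and> odd (d n)"
      "\<And>m n. m \<noteq> n \<Longrightarrow> coprime (d m) (d n)"
      "\<And>n. \<exists>F. finite F \<and> F \<subseteq> splitting_primes (range d) \<and> real n \<le> sum prime_weight F"
    using ex_radicands by blast
  interpret multiquad_tower d
    using d(1,2) by unfold_locales auto
  let ?t = "\<lambda>i. INF M\<in>{M. subfield M Qbar \<and> multiquad d i \<subset> M \<and> M \<subseteq> multiquad d (Suc i)}.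
    real (ideal_norm (multiquad d i) (rel_discriminant (multiquad d i) M)) powr
      (1 / (real (ext_degree (multiquad d 0) M) * real (ext_degree (multiquad d i) M)))"
  have le: "real i powr (1 / 4) \<le> ?t i" for i
    using powr_mono2[of "1 / 4" "real i" "real (d i)"] d(1)[of i] discriminant_term_ge[of i] by linarith
  have "filterlim (\<lambda>i. sqrt (sqrt (real i))) at_top sequentially"
    by (intro filterlim_compose[OF sqrt_at_top] filterlim_real_sequentially)
  then have powr_lim: "filterlim (\<lambda>i. real i powr (1 / 4)) at_top sequentially"
    by (simp add: powr_half_sqrt[symmetric] powr_powr)
  have lim: "filterlim ?t at_top sequentially"
    by (rule filterlim_at_top_mono[OF powr_lim always_eventually]) (intro allI le)
  have S: "property_S L"
    unfolding property_S_def using galois_ext_L S_total_L[OF d(3)] by (rule conjI)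
  have "(\<forall>i. number_field (multiquad d i)) \<and> (\<forall>i. multiquad d i \<subset> multiquad d (Suc i)) \<and>
      L = (\<Union>i. multiquad d i) \<and> filterlim ?t at_top sequentially"
    by (intro conjI allI number_field_K K_strict_mono L_def lim)
  then show ?thesis
    by (intro exI[of _ L] conjI galois_ext_L infinite_ext_L L_subset_Q2ab S) (rule exI)
qed

end
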